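(* Let $X$ be a nonzero complex Banach space with open unit ball $\mathbb{B}_X$, let $m\in\mathbb{N}$, let $a=(a_1,a_2,\ldots,a_m)\in\overline{\mathbb{D}^m}$, and let $F:\mathbb{B}_X\to\overline{\mathbb{D}^m}$ be a holomorphic mapping with the expansion $$F(z)=a+\sum_{n=1}^\infty P_n(z),\quad z\in\mathbb{B}_X,$$ where $P_n(z)=\frac{1}{n!}D^nF(0)(z^n)$ for $n\ge 1$. Assume that $|a_i|=\Vert a\Vert_\infty$ for all $i\in\{1,2,\ldots,m\}$. Let $k\in\mathbb{N}$ (so $k\ge 1$) and let $\nu:\mathbb{B}_X\to\mathbb{B}_X$ be a Schwarz mapping with $\nu(0)=D\nu(0)=\cdots=D^{k-1}\nu(0)=0$. Then $$\Vert F(\nu(z))\Vert_\infty+\sum_{n=1}^\infty\Vert P_n(z)\Vert_\infty+\left(\frac{1}{1+\Vert a\Vert_\infty}+\frac{\Vert z\Vert_X}{1-\Vert z\Vert_X}\right)\sum_{n=1}^\infty\Vert P_n(z)\Vert_\infty^2\le 1$$ for all $z\in\mathbb{B}_X$ with $\Vert z\Vert_X=r\le r_k$, where $r_k\in(0,1)$ is the positive root of the equation $$\frac{1-r^k}{1+r^k}-\frac{2r}{1-r}=0.$$ For each $k\in\mathbb{N}$ the number $r_k$ cannot be improved, i.e. for no $R\in(r_k,1)$ does the inequality hold for all such $F$ and $\nu$ and all $z$ with $\Vert z\Vert_X\le R$.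
   Context: $\mathbb{D}=\{t\in\mathbb{C}:|t|<1\}$. For $w=(w_1,\ldots,w_m)\in\mathbb{C}^m$, $\Vert w\Vert_\infty=\max_{1\le i\le m}|w_i|$; $\mathbb{D}^m=\{w\in\mathbb{C}^m:\Vert w\Vert_\infty<1\}$ is the unit polydisc and $\overline{\mathbb{D}^m}$ its closure. $\mathbb{B}_X=\{z\in X:\Vert z\Vert_X<1\}$. For a holomorphic mapping $G$ from $\mathbb{B}_X$ into a complex Banach space $Y$, $D^nG(0)$ denotes the $n$-th Fréchet derivative of $G$ at $0$, a bounded symmetric $n$-linear mapping from $X\times\cdots\times X$ ($n$ factors) to $Y$, and $D^nG(0)(z^n)=D^nG(0)(z,\ldots,z)$ ($n$ copies of $z$). Thus $P_n$ is the $n$-homogeneous polynomial term in the expansion of $F$ at the origin, and $a=F(0)$. A Schwarz mapping is a holomorphic mapping $\nu:\mathbb{B}_X\to\mathbb{B}_X$ with $\nu(0)=0$. *)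

theory Defs
  imports "HOL-Analysis.Analysis"
begin

class complex_normed_vector = real_normed_vector +
  fixes scaleC :: "complex \<Rightarrow> 'a \<Rightarrow> 'a"  (infixr "*\<^sub>C" 75)
  assumes scaleC_add_right: "c *\<^sub>C (x + y) = c *\<^sub>C x + c *\<^sub>C y"
    and scaleC_add_left: "(c + d) *\<^sub>C x = c *\<^sub>C x + d *\<^sub>C x"
    and scaleC_scaleC: "c *\<^sub>C d *\<^sub>C x = (c * d) *\<^sub>C x"
    and scaleC_of_real: "complex_of_real r *\<^sub>C x = r *\<^sub>R x"
    and norm_scaleC: "norm (c *\<^sub>C x) = cmod c * norm x"

class complex_banach = complex_normed_vector + banach

instantiation complex :: complex_banach
begin

definition "scaleC_complex (c::complex) (x::complex) = c * x"

instance
  by standard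
    (simp_all add: scaleC_complex_def algebra_simps norm_mult scaleR_conv_of_real)

end

instantiation vec :: (complex_normed_vector, finite) complex_normed_vector
begin

definition "scaleC_vec (c::complex) (x::('a, 'b) vec) = (\<chi> i. c *\<^sub>C x $ i)"

instance
proof
  fix c d :: complex and r :: real and x y :: "('a, 'b) vec"
  show "c *\<^sub>C (x + y) = c *\<^sub>C x + c *\<^sub>C y"
    by (simp add: scaleC_vec_def vec_eq_iff scaleC_add_right)
  show "(c + d) *\<^sub>C x = c *\<^sub>C x + d *\<^sub>C x"
    by (simp add: scaleC_vec_def vec_eq_iff scaleC_add_left)
  show "c *\<^sub>C d *\<^sub>C x = (c * d) *\<^sub>C x"
    by (simp add: scaleC_vec_def vec_eq_iff scaleC_scaleC)
  show "complex_of_real r *\<^sub>C x = r *\<^sub>R x"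
    by (simp add: scaleC_vec_def vec_eq_iff scaleC_of_real)
  show "norm (c *\<^sub>C x) = cmod c * norm x"
    by (simp add: scaleC_vec_def norm_vec_def norm_scaleC L2_set_right_distrib)
qed

end

instance vec :: (complex_banach, finite) complex_banach ..

definition holomorphic_map ::
  "'a::complex_normed_vector set \<Rightarrow> ('a \<Rightarrow> 'b::complex_normed_vector) \<Rightarrow> bool" where
  "holomorphic_map S f \<longleftrightarrow> open S \<and>
     (\<forall>x\<in>S. \<exists>L. (f has_derivative L) (at x) \<and> (\<forall>c v. L (c *\<^sub>C v) = c *\<^sub>C L v))"

text \<open>
  An \<open>n\<close>-linear map is represented by a function on lists of length \<open>n\<close> (the list of its
  arguments), normalised to be \<open>0\<close> on lists of any other length, so that it is determined by
  its values on \<open>n\<close>-tuples.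
\<close>

definition bounded_multilinear ::
  "nat \<Rightarrow> ('a::complex_normed_vector list \<Rightarrow> 'b::complex_normed_vector) \<Rightarrow> bool" where
  "bounded_multilinear n L \<longleftrightarrow>
     (\<forall>us ws x y. length us + length ws + 1 = n \<longrightarrow>
        L (us @ (x + y) # ws) = L (us @ x # ws) + L (us @ y # ws)) \<and>
     (\<forall>us ws c x. length us + length ws + 1 = n \<longrightarrow>
        L (us @ (c *\<^sub>C x) # ws) = c *\<^sub>C L (us @ x # ws)) \<and>
     (\<exists>C. \<forall>vs. length vs = n \<longrightarrow> norm (L vs) \<le> C * prod_list (map norm vs)) \<and>
     (\<forall>vs. length vs \<noteq> n \<longrightarrow> L vs = 0)"

text \<open>
  Frechet differentiability at \<open>x\<close> of a map \<open>G\<close> with values in the space of bounded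
  \<open>n\<close>-linear maps, with respect to the multilinear operator norm (the estimate is uniform in
  \<open>vs\<close>). The derivative, a bounded linear map into that space, is identified with
  an \<open>(n+1)\<close>-linear map whose first argument is the direction of differentiation.
\<close>

definition has_multilinear_derivative ::
  "nat \<Rightarrow> ('a::complex_normed_vector \<Rightarrow> 'a list \<Rightarrow> 'b::complex_normed_vector) \<Rightarrow>
     ('a list \<Rightarrow> 'b) \<Rightarrow> 'a \<Rightarrow> bool" where
  "has_multilinear_derivative n G L x \<longleftrightarrow> bounded_multilinear (Suc n) L \<and>
     (\<forall>e>0. \<forall>\<^sub>F y in at x. \<forall>vs. length vs = n \<longrightarrow>
        norm (G y vs - G x vs - L ((y - x) # vs)) \<le> e * norm (y - x) * prod_list (map norm vs))"

text \<open>\<open>nth_frechet n f x [v\<^sub>1, \<dots>, v\<^sub>n]\<close> is \<open>D\<^sup>nf(x)(v\<^sub>1, \<dots>, v\<^sub>n)\<close>.\<close>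

primrec nth_frechet ::
  "nat \<Rightarrow> ('a::complex_normed_vector \<Rightarrow> 'b::complex_normed_vector) \<Rightarrow> 'a \<Rightarrow> 'a list \<Rightarrow> 'b" where
  "nth_frechet 0 f = (\<lambda>x vs. if vs = [] then f x else 0)"
| "nth_frechet (Suc n) f = (\<lambda>x. THE L. has_multilinear_derivative n (nth_frechet n f) L x)"

definition taylor_term ::
  "('a::complex_normed_vector \<Rightarrow> 'b::complex_normed_vector) \<Rightarrow> nat \<Rightarrow> 'a \<Rightarrow> 'b" where
  "taylor_term f n z = (1 / fact n) *\<^sub>R nth_frechet n f 0 (replicate n z)"

text \<open>
  The library norm on \<open>complex ^ 'm\<close> is the Euclidean one (and \<open>infnorm\<close> takes the maximum over
  real and imaginary parts), so the maximum norm is introduced separately. Holomorphy, derivatives,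
  closures and convergence do not depend on which of these equivalent norms is used.
\<close>

definition maxnorm :: "complex ^ 'm \<Rightarrow> real" where
  "maxnorm w = Max (range (\<lambda>i. cmod (w $ i)))"

definition polydisc :: "(complex ^ 'm) set" where
  "polydisc = {w. maxnorm w < 1}"

definition polydisc_map ::
  "complex ^ 'm \<Rightarrow> ('a::complex_normed_vector \<Rightarrow> complex ^ 'm) \<Rightarrow> bool" where
  "polydisc_map a F \<longleftrightarrow>
     a \<in> closure polydisc \<and>
     holomorphic_map (ball 0 1) F \<and>
     F ` ball 0 1 \<subseteq> closure polydisc \<and>
     F 0 = a \<and>
     (\<forall>z\<in>ball 0 1. (\<lambda>n. taylor_term F (Suc n) z) sums (F z - a)) \<and>
     (\<forall>i. cmod (a $ i) = maxnorm a)"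

definition schwarz_map :: "('a::complex_normed_vector \<Rightarrow> 'a) \<Rightarrow> bool" where
  "schwarz_map \<nu> \<longleftrightarrow> holomorphic_map (ball 0 1) \<nu> \<and> \<nu> ` ball 0 1 \<subseteq> ball 0 1 \<and> \<nu> 0 = 0"

definition vanishes_to_order ::
  "nat \<Rightarrow> ('a::complex_normed_vector \<Rightarrow> 'b::complex_normed_vector) \<Rightarrow> bool" where
  "vanishes_to_order k f \<longleftrightarrow> (\<forall>j<k. nth_frechet j f 0 = (\<lambda>_. 0))"

definition bohr_lhs ::
  "complex ^ 'm \<Rightarrow> ('a::complex_normed_vector \<Rightarrow> complex ^ 'm) \<Rightarrow> ('a \<Rightarrow> 'a) \<Rightarrow> 'a \<Rightarrow> real" where
  "bohr_lhs a F \<nu> z =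
     maxnorm (F (\<nu> z)) + (\<Sum>n. maxnorm (taylor_term F (Suc n) z)) +
     (1 / (1 + maxnorm a) + norm z / (1 - norm z)) *
       (\<Sum>n. (maxnorm (taylor_term F (Suc n) z))\<^sup>2)"

text \<open>The bound \<open>r < 1\<close> also excludes the spurious root \<open>r = 1\<close> caused by \<open>x / 0 = 0\<close>.\<close>

definition is_bohr_root :: "nat \<Rightarrow> real \<Rightarrow> bool" where
  "is_bohr_root k r \<longleftrightarrow>
     0 < r \<and> r < 1 \<and> (1 - r ^ k) / (1 + r ^ k) - 2 * r / (1 - r) = 0"

definition bohr_radius :: "nat \<Rightarrow> real" where
  "bohr_radius k = (THE r. is_bohr_root k r)"

end

theory Submission
  imports Defs "HOL-Complex_Analysis.Complex_Analysis"
begin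

text \<open>
  Write \<open>\<alpha>\<close> for the common modulus of the coordinates of \<open>a\<close> and \<open>r\<close> for the norm of \<open>z\<close>.

  \<^bold>\<open>The inequality.\<close> Restricted to the disc \<open>t \<mapsto> t z / r\<close>, every coordinate of \<open>F\<close> is a
  holomorphic function of modulus at most \<open>1\<close> on the unit disc whose value at \<open>0\<close> has modulus
  \<open>\<alpha>\<close>. Its Taylor coefficients of positive index are therefore bounded by \<open>1 - \<alpha>\<^sup>2\<close>
  (\<open>bounded_coefficient\<close>); this holds in all coordinates at once, so the maximum norm of
  \<open>P\<^sub>n(z)\<close> is at most \<open>(1 - \<alpha>\<^sup>2) r\<^sup>n\<close>. Both series are thus dominated by geometric ones. The
  Schwarz-Pick lemma bounds \<open>F(\<nu>(z))\<close> by \<open>(\<alpha> + x) / (1 + \<alpha> x)\<close> with \<open>x\<close> the norm of \<open>\<nu>(z)\<close>, and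
  the Schwarz lemma for a zero of order \<open>k\<close> gives \<open>x \<le> r\<^sup>k\<close>. What remains is an inequality
  between real numbers. The root \<open>r\<^sub>k\<close> is at most \<open>1/3\<close>, and for \<open>r \<le> 1/3\<close> the two majorants add
  up to at most \<open>(1 - \<alpha>) 2r / (1 - r)\<close> (\<open>bohr_majorant_le\<close>), while the norm of
  \<open>F(\<nu>(z))\<close> falls short of \<open>1\<close> by at least \<open>(1 - \<alpha>) (1 - r\<^sup>k) / (1 + r\<^sup>k)\<close>. For \<open>r \<le> r\<^sub>k\<close>
  the latter quantity is the larger one, with equality of the factors of \<open>1 - \<alpha>\<close> at the root.

  The coefficients are estimated one at a time because the maximum over the coordinates may be
  attained in a different coordinate for each \<open>n\<close>: joint bounds for the coefficients of a single
  bounded function, such as those on the sum of their squares, fail for the maxima.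

  \<^bold>\<open>Sharpness.\<close> Choose a functional \<open>\<phi>\<close> of norm one that attains its norm at a unit vector \<open>e\<close>,
  let all coordinates of \<open>F\<close> be \<open>(\<alpha> - \<phi>) / (1 - \<alpha> \<phi>)\<close>, let \<open>\<nu>(z) = - \<phi>(z)\<^sup>k\<^sup>-\<^sup>1 z\<close> and take
  \<open>z = R e\<close>. The first two terms alone then have the sum
  \<open>(\<alpha> + R\<^sup>k) / (1 + \<alpha> R\<^sup>k) + (1 - \<alpha>\<^sup>2) R / (1 - \<alpha> R)\<close>, which exceeds \<open>1\<close> for \<open>\<alpha>\<close> close to \<open>1\<close> as
  soon as \<open>R\<close> lies beyond the root.

  \<^bold>\<open>Calculus in Banach spaces.\<close> The terms \<open>P\<^sub>n\<close> and the vanishing of \<open>\<nu>\<close> are expressed by higher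
  Frechet derivatives, so one has to know that a map that is merely complex differentiable has
  derivatives of all orders, uniformly in the remaining arguments. Norm estimates for vector
  valued maps reduce to the classical one variable estimates by means of norming functionals
  (\<open>ex_norming_functional\<close>, a form of the Hahn-Banach theorem). These estimates show that difference
  quotients converge locally uniformly, whence directional derivatives of holomorphic maps are
  again holomorphic (\<open>holomorphic_map_cderiv\<close>). Iterating this produces the multilinear derivatives
  (\<open>nth_frechet_eq_iter_deriv\<close>), and along complex lines through the origin they are the ordinary
  Taylor coefficients (\<open>slice_power_series\<close>).
\<close>

section \<open>Norming functionals\<close>

definition sublinear :: "('a::real_vector \<Rightarrow> real) \<Rightarrow> bool" where
  "sublinear p \<longleftrightarrow> (\<forall>x y. p (x + y) \<le> p x + p y) \<and> (\<forall>t x. t > 0 \<longrightarrow> p (t *\<^sub>R x) \<le> t * p x)"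

lemma sublinear_zero:
  assumes "sublinear p" shows "p 0 = 0"
proof -
  have "p (0 + 0) \<le> p 0 + p 0" and "p ((1/2) *\<^sub>R 0) \<le> (1/2) * p 0"
    using assms unfolding sublinear_def by (blast, meson half_gt_zero_iff zero_less_one)
  then show ?thesis by simp
qed

lemma sublinear_ge_neg:
  assumes "sublinear p" shows "- p (- x) \<le> p x"
proof -
  have "p (x + - x) \<le> p x + p (- x)" using assms unfolding sublinear_def by blast
  then show ?thesis using sublinear_zero[OF assms] by simp
qed

text \<open>
  Any sublinear functional can be lowered so that it becomes odd at one prescribed point. It serves
  twice: it shows that a minimal sublinear functional is linear, and, applied to the norm, it forces
  a linear functional lying below to attain the norm at \<open>x0\<close>.
\<close>

lemma sublinear_tilt:
  fixes p :: "'a::real_vector \<Rightarrow> real"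
  assumes p: "sublinear p"
  shows "\<exists>p'. sublinear p' \<and> (\<forall>x. p' x \<le> p x) \<and> p' (- x0) \<le> - p x0"
proof -
  have sub: "p (x + y) \<le> p x + p y" for x y using p unfolding sublinear_def by blast
  have hom: "p (t *\<^sub>R x) \<le> t * p x" if "t \<ge> 0" for t x
    using p that sublinear_zero[OF p] unfolding sublinear_def by (cases "t = 0") auto
  define q where "q x = (INF t\<in>{0..}. p (x + t *\<^sub>R x0) - t * p x0)" for x
  have lower: "- p (- x) \<le> p (x + t *\<^sub>R x0) - t * p x0" if "t \<ge> 0" for x t
  proof -
    have "t * p x0 \<le> p (t *\<^sub>R x0)"
      using hom[of "inverse t" "t *\<^sub>R x0"] that sublinear_zero[OF p]
      by (cases "t = 0") (auto simp: field_simps)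
    also have "\<dots> \<le> p (x + t *\<^sub>R x0) + p (- x)"
      using sub[of "x + t *\<^sub>R x0" "- x"] by simp
    finally show ?thesis by simp
  qed
  have bdd: "bdd_below ((\<lambda>t. p (x + t *\<^sub>R x0) - t * p x0) ` {0..})" for x
    using lower by (intro bdd_belowI2[of _ "- p (- x)"]) auto
  have q_le: "q x \<le> p (x + t *\<^sub>R x0) - t * p x0" if "t \<ge> 0" for x t
    unfolding q_def using bdd that by (intro cINF_lower) auto
  have q_ge: "b \<le> q x" if "\<And>t. t \<ge> 0 \<Longrightarrow> b \<le> p (x + t *\<^sub>R x0) - t * p x0" for b x
    unfolding q_def using that by (intro cINF_greatest) auto
  have "q (x + y) \<le> q x + q y" for x y
  proof -
    have "q (x + y) - (p (y + s *\<^sub>R x0) - s * p x0) \<le> q x" if s: "s \<ge> 0" for s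
    proof (rule q_ge)
      fix t :: real assume t: "t \<ge> 0"
      have "q (x + y) \<le> p (x + y + (s + t) *\<^sub>R x0) - (s + t) * p x0" using q_le s t by simp
      also have "x + y + (s + t) *\<^sub>R x0 = (x + t *\<^sub>R x0) + (y + s *\<^sub>R x0)"
        by (simp add: algebra_simps)
      finally show "q (x + y) - (p (y + s *\<^sub>R x0) - s * p x0) \<le> p (x + t *\<^sub>R x0) - t * p x0"
        using sub[of "x + t *\<^sub>R x0" "y + s *\<^sub>R x0"] by (simp add: algebra_simps)
    qed
    then have "q (x + y) - q x \<le> q y" by (intro q_ge) (simp add: algebra_simps)
    then show ?thesis by simp
  qed
  moreover have "q (c *\<^sub>R x) \<le> c * q x" if c: "c > 0" for c x
  proof -
    have "q (c *\<^sub>R x) / c \<le> q x"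
    proof (rule q_ge)
      fix t :: real assume t: "t \<ge> 0"
      have "q (c *\<^sub>R x) \<le> p (c *\<^sub>R x + (c * t) *\<^sub>R x0) - c * t * p x0" using q_le c t by simp
      also have "p (c *\<^sub>R x + (c * t) *\<^sub>R x0) \<le> c * p (x + t *\<^sub>R x0)"
        using hom[of c "x + t *\<^sub>R x0"] c by (simp add: algebra_simps)
      finally show "q (c *\<^sub>R x) / c \<le> p (x + t *\<^sub>R x0) - t * p x0"
        using c by (simp add: field_simps)
    qed
    then show ?thesis using c by (simp add: field_simps)
  qed
  moreover have "q x \<le> p x" for x using q_le[of 0 x] by simp
  moreover have "q (- x0) \<le> - p x0" using q_le[of 1 "- x0"] sublinear_zero[OF p] by simp
  ultimately show ?thesis unfolding sublinear_def by blast
qed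

text \<open>
  Pointwise infima of chains of sublinear functionals are sublinear, so by Zorn's lemma there is a
  minimal one below \<open>q\<close>. By \<open>sublinear_tilt\<close> it is odd, and an odd sublinear functional is linear.
\<close>

lemma ex_linear_below_sublinear:
  fixes q :: "'a::real_vector \<Rightarrow> real"
  assumes q: "sublinear q"
  shows "\<exists>p. linear p \<and> (\<forall>x. p x \<le> q x)"
proof -
  define A where "A = {p. sublinear p \<and> p \<le> q}"
  define P where "P f g \<longleftrightarrow> g \<le> f" for f g :: "'a \<Rightarrow> real"
  have "\<exists>m\<in>A. \<forall>a\<in>A. P m a \<longrightarrow> a = m"
  proof (rule predicate_Zorn)
    show "partial_order_on A (relation_of P A)"
      by (rule partial_order_on_relation_ofI) (auto simp: P_def)
    fix C assume C: "C \<in> Chains (relation_of P A)"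
    then have CA: "C \<subseteq> A" by (simp add: Chains_relation_of)
    have tot: "f \<le> g \<or> g \<le> f" if "f \<in> C" "g \<in> C" for f g
      using C that unfolding Chains_def relation_of_def P_def by auto
    show "\<exists>u\<in>A. \<forall>a\<in>C. P a u"
    proof (cases "C = {}")
      case True
      then show ?thesis using q by (auto simp: A_def)
    next
      case False
      define u where "u x = (INF f\<in>C. f x)" for x
      have bdd: "bdd_below ((\<lambda>f. f x) ` C)" for x
      proof (rule bdd_belowI2[of _ "- q (- x)"])
        fix f assume "f \<in> C"
        then have "sublinear f" "f (- x) \<le> q (- x)" using CA by (auto simp: A_def le_fun_def)
        then show "- q (- x) \<le> f x" using sublinear_ge_neg[of f x] by linarith
      qed
      have u_le: "u x \<le> f x" if "f \<in> C" for f x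
        unfolding u_def using bdd that by (intro cINF_lower) auto
      have u_ge: "b \<le> u x" if "\<And>f. f \<in> C \<Longrightarrow> b \<le> f x" for b x
        unfolding u_def using that False by (intro cINF_greatest) auto
      have sl: "sublinear f" if "f \<in> C" for f using CA that by (auto simp: A_def)
      have "u (x + y) \<le> u x + u y" for x y
      proof -
        have *: "u (x + y) \<le> f x + g y" if "f \<in> C" "g \<in> C" for f g
        proof -
          from tot[OF that] consider "f \<le> g" | "g \<le> f" by blast
          then show ?thesis
          proof cases
            case 1
            have "u (x + y) \<le> f x + f y"
              using u_le[OF that(1), of "x + y"] sl[OF that(1)] unfolding sublinear_def
              by (meson order_trans)
            then show ?thesis using 1 by (smt (verit) le_fun_def)
          next
            case 2
            have "u (x + y) \<le> g x + g y"
              using u_le[OF that(2), of "x + y"] sl[OF that(2)] unfolding sublinear_def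
              by (meson order_trans)
            then show ?thesis using 2 by (smt (verit) le_fun_def)
          qed
        qed
        have "u (x + y) - g y \<le> u x" if "g \<in> C" for g
          using *[OF _ that] by (intro u_ge) (simp add: algebra_simps)
        then have "u (x + y) - u x \<le> u y" by (intro u_ge) (simp add: algebra_simps)
        then show ?thesis by simp
      qed
      moreover have "u (c *\<^sub>R x) \<le> c * u x" if c: "c > 0" for c x
      proof -
        have "u (c *\<^sub>R x) / c \<le> u x"
        proof (rule u_ge)
          fix f assume f: "f \<in> C"
          have "u (c *\<^sub>R x) \<le> c * f x"
            using u_le[OF f] sl[OF f] c unfolding sublinear_def by (meson order_trans)
          then show "u (c *\<^sub>R x) / c \<le> f x" using c by (simp add: field_simps)
        qed
        then show ?thesis using c by (simp add: field_simps)
      qed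
      moreover have "u \<le> q"
      proof -
        obtain f where "f \<in> C" using False by blast
        then show ?thesis using u_le CA unfolding A_def le_fun_def by (blast intro: order_trans)
      qed
      ultimately have "u \<in> A" unfolding A_def sublinear_def by blast
      then show ?thesis using u_le unfolding P_def le_fun_def by blast
    qed
  qed
  then obtain p where p: "sublinear p" "p \<le> q"
    and min: "\<And>p'. sublinear p' \<Longrightarrow> p' \<le> p \<Longrightarrow> p' = p"
    unfolding A_def P_def by (blast intro: order_trans)
  have neg: "p (- x) = - p x" for x
  proof -
    obtain p' where "sublinear p'" "p' \<le> p" "p' (- x) \<le> - p x"
      using sublinear_tilt[OF p(1), of x] by (auto simp: le_fun_def)
    then have "p (- x) \<le> - p x" using min by metis
    then show ?thesis using sublinear_ge_neg[OF p(1), of x] by simp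
  qed
  have sub: "p (x + y) \<le> p x + p y" for x y using p(1) unfolding sublinear_def by blast
  have hom: "p (t *\<^sub>R x) = t * p x" if "t > 0" for t x
  proof -
    have "p (t *\<^sub>R x) \<le> t * p x" "p (t *\<^sub>R (- x)) \<le> t * p (- x)"
      using p(1) that unfolding sublinear_def by blast+
    then show ?thesis by (simp add: neg)
  qed
  have "linear p"
  proof (rule linearI)
    show "p (x + y) = p x + p y" for x y
      using sub[of x y] sub[of "x + y" "- y"] by (simp add: neg)
    show "p (t *\<^sub>R x) = t *\<^sub>R p x" for t x
      using hom[of t x] hom[of "- t" x] neg[of "t *\<^sub>R x"] sublinear_zero[OF p(1)]
      by (cases "t > 0"; cases "t = 0") auto
  qed
  then show ?thesis using p(2) by (auto simp: le_fun_def)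
qed

text \<open>
  Operator norm at most one is part of the definition, so that \<open>\<phi> \<circ> f\<close> inherits every bound of \<open>f\<close>.
\<close>

definition functional :: "('a::complex_normed_vector \<Rightarrow> complex) \<Rightarrow> bool" where
  "functional \<phi> \<longleftrightarrow> (\<forall>u v. \<phi> (u + v) = \<phi> u + \<phi> v) \<and> (\<forall>c v. \<phi> (c *\<^sub>C v) = c * \<phi> v) \<and>
     (\<forall>v. cmod (\<phi> v) \<le> norm v)"

theorem ex_norming_functional:
  fixes x0 :: "'a::complex_normed_vector"
  shows "\<exists>\<phi>. functional \<phi> \<and> \<phi> x0 = complex_of_real (norm x0)"
proof -
  have "sublinear (norm :: 'a \<Rightarrow> real)"
    by (auto simp: sublinear_def norm_triangle_ineq)
  from sublinear_tilt[OF this, of x0] obtain q :: "'a \<Rightarrow> real"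
    where q: "sublinear q" "\<And>x. q x \<le> norm x" "q (- x0) \<le> - norm x0"
    by auto
  from ex_linear_below_sublinear[OF q(1)] obtain p
    where p: "linear p" "\<And>x. p x \<le> q x" by auto
  have pn: "p x \<le> norm x" for x using p(2) q(2) order_trans by blast
  have padd: "p (x + y) = p x + p y" and psc: "p (t *\<^sub>R x) = t * p x" and pdiff: "p (x - y) = p x - p y" for x y t
    using p(1) by (simp_all add: linear_add linear_scale linear_diff)
  \<comment> \<open>A real linear functional is the real part of exactly one complex linear one.\<close>
  define \<phi> where "\<phi> x = Complex (p x) (- p (\<i> *\<^sub>C x))" for x
  have dec: "c *\<^sub>C x = Re c *\<^sub>R x + Im c *\<^sub>R (\<i> *\<^sub>C x)" for c and x :: 'a
  proof -
    have "c *\<^sub>C x = (complex_of_real (Re c) + complex_of_real (Im c) * \<i>) *\<^sub>C x"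
      using complex_eq[of c] by (simp add: mult.commute)
    also have "\<dots> = Re c *\<^sub>R x + Im c *\<^sub>R (\<i> *\<^sub>C x)"
      by (simp only: scaleC_add_left scaleC_of_real flip: scaleC_scaleC)
    finally show ?thesis .
  qed
  have add: "\<phi> (u + v) = \<phi> u + \<phi> v" for u v
    by (simp add: \<phi>_def padd scaleC_add_right complex_eq_iff)
  have hom: "\<phi> (c *\<^sub>C v) = c * \<phi> v" for c v
  proof -
    have "\<i> *\<^sub>C (c *\<^sub>C v) = (\<i> * c) *\<^sub>C v" by (simp add: scaleC_scaleC)
    then show ?thesis
      by (simp add: \<phi>_def dec[of c] dec[of "\<i> * c"] padd pdiff psc complex_eq_iff)
  qed
  have bound: "cmod (\<phi> v) \<le> norm v" for v
  proof (cases "\<phi> v = 0")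
    case False
    \<comment> \<open>Rotating \<open>v\<close> makes the value of \<open>\<phi>\<close> real and hence equal to a value of \<open>p\<close>.\<close>
    define c where "c = cnj (\<phi> v) / cmod (\<phi> v)"
    have c: "cmod c = 1" using False by (simp add: c_def norm_divide)
    have "\<phi> (c *\<^sub>C v) = complex_of_real (cmod (\<phi> v))"
      unfolding hom c_def using False complex_norm_square[of "\<phi> v"]
      by (simp add: field_simps power2_eq_square)
    then have "cmod (\<phi> v) = p (c *\<^sub>C v)" unfolding \<phi>_def by (simp add: complex_eq_iff)
    also have "\<dots> \<le> norm v" using pn[of "c *\<^sub>C v"] c by (simp add: norm_scaleC)
    finally show ?thesis .
  qed simp
  have "norm x0 \<le> p x0"
    using q(3) p(2)[of "- x0"] linear_neg[OF p(1), of x0] by simp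
  then have re: "Re (\<phi> x0) = norm x0" using pn[of x0] by (simp add: \<phi>_def)
  then have "Im (\<phi> x0) = 0" using bound[of x0] cmod_power2[of "\<phi> x0"]
    by (smt (verit) norm_ge_zero power_mono zero_less_power2)
  then have "\<phi> x0 = complex_of_real (norm x0)" using re by (simp add: complex_eq_iff)
  then show ?thesis using add hom bound unfolding functional_def by blast
qed

section \<open>Bounded holomorphic functions on the unit disc\<close>

lemma power_series_factor:
  fixes d :: "nat \<Rightarrow> complex"
  assumes sums: "\<And>s. s \<in> ball 0 1 \<Longrightarrow> (\<lambda>m. d m * s ^ m) sums h s"
    and zero: "\<And>j. j < n \<Longrightarrow> d j = 0"
  obtains q where "q holomorphic_on ball 0 1" "\<And>s. s \<in> ball 0 1 \<Longrightarrow> h s = s ^ n * q s" "q 0 = d n"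
proof
  define q where "q s = (if s = 0 then d n else h s / s ^ n)" for s
  have tail: "(\<lambda>m. d (m + n) * s ^ (m + n)) sums h s" if "s \<in> ball 0 1" for s
    using sums_split_initial_segment[OF sums[OF that], of n] zero by simp
  have "(\<lambda>m. d (m + n) * (s - 0) ^ m) sums q s" if s: "s \<in> ball 0 1" for s
  proof (cases "s = 0")
    case True
    then show ?thesis using powser_sums_zero[of "\<lambda>m. d (m + n)"] by (simp add: q_def)
  next
    case False
    then show ?thesis
      using sums_divide[OF tail[OF s], of "s ^ n"] by (simp add: q_def power_add field_simps)
  qed
  then show "q holomorphic_on ball 0 1" by (rule power_series_holomorphic)
  have h0: "h 0 = d 0"
    using sums[of 0] powser_sums_zero[of d] sums_unique2 by fastforce
  show "h s = s ^ n * q s" if "s \<in> ball 0 1" for s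
    using h0 zero[of 0] by (cases "n = 0") (auto simp: q_def)
  show "q 0 = d n" by (simp add: q_def)
qed

text \<open>
  On the circle of radius \<open>\<rho>\<close> the hypothesis says that \<open>q\<close> is bounded by \<open>1 / \<rho>\<^sup>n\<close>. The maximum
  principle carries this bound inside, and \<open>\<rho>\<close> tends to \<open>1\<close>.
\<close>

lemma cofactor_le_one:
  assumes q: "q holomorphic_on ball 0 1"
    and le: "\<And>s. s \<in> ball 0 1 \<Longrightarrow> cmod (s ^ n * q s) \<le> 1"
    and t: "t \<in> ball 0 1"
  shows "cmod (q t) \<le> 1"
proof -
  have main: "\<rho> ^ n * cmod (q t) \<le> 1" if \<rho>: "cmod t < \<rho>" "\<rho> < 1" for \<rho>
  proof -
    have \<rho>0: "0 < \<rho>" using \<rho> norm_ge_zero[of t] by linarith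
    have "cmod (q t) \<le> 1 / \<rho> ^ n"
    proof (rule maximum_modulus_frontier[where f = q and S = "ball 0 \<rho>"])
      show "q holomorphic_on interior (ball 0 \<rho>)"
        using \<rho> by (auto intro: holomorphic_on_subset[OF q])
      have "cball 0 \<rho> \<subseteq> ball (0::complex) 1" using \<rho> by auto
      then show "continuous_on (closure (ball 0 \<rho>)) q"
        using \<rho>0 holomorphic_on_imp_continuous_on[OF q] continuous_on_subset by auto
      show "cmod (q z) \<le> 1 / \<rho> ^ n" if "z \<in> frontier (ball 0 \<rho>)" for z
      proof -
        have z: "cmod z = \<rho>" using that \<rho>0 by (simp add: frontier_ball)
        then show ?thesis using le[of z] \<rho> \<rho>0 by (simp add: norm_mult norm_power field_simps)
      qed
    qed (use \<rho> in auto)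
    then show ?thesis using \<rho>0 by (simp add: field_simps)
  qed
  have "((\<lambda>\<rho>. \<rho> ^ n * cmod (q t)) \<longlongrightarrow> 1 ^ n * cmod (q t)) (at_left 1)"
    by (intro tendsto_intros)
  moreover have "\<forall>\<^sub>F \<rho> in at_left (1::real). \<rho> ^ n * cmod (q t) \<le> 1"
    using eventually_at_left_real[of "cmod t" 1] t main by (auto elim!: eventually_mono)
  ultimately show ?thesis
    using tendsto_upperbound by (metis mult_1 power_one trivial_limit_at_left_real)
qed

lemma moebius_identity:
  "(cmod (1 - cnj a * w))\<^sup>2 - (cmod (w - a))\<^sup>2 = (1 - (cmod a)\<^sup>2) * (1 - (cmod w)\<^sup>2)"
  unfolding cmod_power2 by (simp add: power2_eq_square algebra_simps)

text \<open>
  The Moebius transformation sending \<open>g 0\<close> to \<open>0\<close> turns \<open>g\<close> into a bounded function with cofactor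
  \<open>q / (1 - cnj (g 0) * g)\<close> at the origin. For \<open>n = 1\<close> this is the Schwarz-Pick lemma; evaluated at
  \<open>t = 0\<close> it bounds the coefficient of index \<open>n\<close> of a function whose coefficients of
  index \<open>1, \<dots>, n - 1\<close> vanish.
\<close>

lemma pick_cofactor:
  assumes g: "g holomorphic_on ball 0 1" and q: "q holomorphic_on ball 0 1"
    and le: "\<And>s. s \<in> ball 0 1 \<Longrightarrow> cmod (g s) \<le> 1" and g0: "cmod (g 0) < 1"
    and eq: "\<And>s. s \<in> ball 0 1 \<Longrightarrow> g s - g 0 = s ^ n * q s"
    and t: "t \<in> ball 0 1"
  shows "cmod (q t) \<le> cmod (1 - cnj (g 0) * g t)"
proof -
  define D where "D s = 1 - cnj (g 0) * g s" for s
  have D0: "D s \<noteq> 0" if "s \<in> ball 0 1" for s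
  proof
    assume "D s = 0"
    then have "cmod (g 0) * cmod (g s) = 1" unfolding D_def
      by (metis complex_mod_cnj eq_iff_diff_eq_0 norm_mult norm_one)
    then show False using le[OF that] g0 mult_left_le[of "cmod (g s)" "cmod (g 0)"] by simp
  qed
  have D: "D holomorphic_on ball 0 1" unfolding D_def by (intro holomorphic_intros g)
  have "cmod (q t / D t) \<le> 1"
  proof (rule cofactor_le_one[where n = n and q = "\<lambda>s. q s / D s"])
    show "(\<lambda>s. q s / D s) holomorphic_on ball 0 1"
      using D0 by (intro holomorphic_intros q D) auto
    show "cmod (s ^ n * (q s / D s)) \<le> 1" if s: "s \<in> ball 0 1" for s
    proof -
      have "(cmod (g s - g 0))\<^sup>2 \<le> (cmod (D s))\<^sup>2"
        using moebius_identity[of "g 0" "g s"] le[OF s] g0 unfolding D_def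
        by (smt (verit) mult_nonneg_nonneg norm_ge_zero power_le_one)
      then have "cmod (g s - g 0) \<le> cmod (D s)" by (rule power2_le_imp_le) simp
      then show ?thesis using D0[OF s] eq[OF s] by (simp add: norm_divide)
    qed
  qed (rule t)
  then show ?thesis using D0[OF t] by (simp add: norm_divide D_def)
qed

text \<open>
  The pseudo-hyperbolic distance of \<open>f w\<close> and \<open>f 0\<close> is at most that of \<open>w\<close> and \<open>0\<close>; the bound is the
  largest modulus in the resulting pseudo-hyperbolic disc around \<open>f 0\<close>.
\<close>

lemma schwarz_pick_growth:
  assumes f: "f holomorphic_on ball 0 1" and le: "\<And>s. s \<in> ball 0 1 \<Longrightarrow> cmod (f s) \<le> 1"
    and w: "w \<in> ball 0 1"
  shows "cmod (f w) \<le> (cmod (f 0) + cmod w) / (1 + cmod (f 0) * cmod w)"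
proof (cases "cmod (f 0) = 1")
  case True
  moreover have "1 + cmod w > 0" by (simp add: add_pos_nonneg)
  ultimately show ?thesis using le[OF w] by simp
next
  case False
  then have f0: "cmod (f 0) < 1" using le[of 0] by simp
  define d where "d m = (if m = 0 then 0 else (deriv ^^ m) f 0 / fact m)" for m
  have ser: "(\<lambda>m. d m * s ^ m) sums (f s - f 0)" if "s \<in> ball 0 1" for s
  proof -
    have "(\<lambda>m. (deriv ^^ m) f 0 / fact m * s ^ m) sums f s"
      using holomorphic_power_series[OF f that] by simp
    moreover have "(\<lambda>m. if m = 0 then f 0 else 0) sums f 0"
      using sums_single[of 0 "\<lambda>_. f 0"] by simp
    ultimately have "(\<lambda>m. (deriv ^^ m) f 0 / fact m * s ^ m - (if m = 0 then f 0 else 0)) sums (f s - f 0)"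
      by (rule sums_diff)
    moreover have "(deriv ^^ m) f 0 / fact m * s ^ m - (if m = 0 then f 0 else 0) = d m * s ^ m" for m
      by (cases m) (simp_all add: d_def del: funpow.simps(2))
    ultimately show ?thesis by simp
  qed
  obtain q where q: "q holomorphic_on ball 0 1"
    "\<And>s. s \<in> ball 0 1 \<Longrightarrow> f s - f 0 = s ^ 1 * q s"
    using power_series_factor[OF ser, of 1] by (auto simp: d_def)
  have "cmod (q w) \<le> cmod (1 - cnj (f 0) * f w)"
    by (rule pick_cofactor[OF f q(1) le f0 q(2) w])
  then have *: "cmod (f w - f 0) \<le> cmod w * cmod (1 - cnj (f 0) * f w)"
    using q(2)[OF w] by (simp add: norm_mult mult_left_mono)
  define \<alpha> \<beta> x where "\<alpha> = cmod (f 0)" and "\<beta> = cmod (f w)" and "x = cmod w"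
  have x: "0 \<le> x" "x < 1" using w by (auto simp: x_def)
  have \<alpha>\<beta>: "0 \<le> \<alpha>" "\<alpha> < 1" "0 \<le> \<beta>" "\<beta> \<le> 1"
    using f0 le[OF w] by (auto simp: \<alpha>_def \<beta>_def)
  have ab1: "\<alpha> * \<beta> \<le> 1" using \<alpha>\<beta> by (simp add: mult_le_one)
  have "1 - \<alpha> * \<beta> \<le> cmod (1 - cnj (f 0) * f w)"
    using norm_triangle_ineq2[of 1 "cnj (f 0) * f w"] by (simp add: norm_mult \<alpha>_def \<beta>_def)
  then have "(1 - x\<^sup>2) * (1 - \<alpha> * \<beta>)\<^sup>2 \<le> (1 - x\<^sup>2) * (cmod (1 - cnj (f 0) * f w))\<^sup>2"
    using ab1 x by (intro mult_left_mono power_mono) (auto simp: power_le_one)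
  also have "\<dots> \<le> (1 - \<alpha>\<^sup>2) * (1 - \<beta>\<^sup>2)"
    using moebius_identity[of "f 0" "f w"] power_mono[OF *, of 2]
    unfolding \<alpha>_def \<beta>_def x_def power_mult_distrib left_diff_distrib by simp
  finally have "(1 - \<alpha> * \<beta>)\<^sup>2 - (1 - \<alpha>\<^sup>2) * (1 - \<beta>\<^sup>2) \<le> x\<^sup>2 * (1 - \<alpha> * \<beta>)\<^sup>2"
    by (simp only: left_diff_distrib)
  \<comment> \<open>The Moebius identity once more, now for the moduli.\<close>
  also have "(1 - \<alpha> * \<beta>)\<^sup>2 - (1 - \<alpha>\<^sup>2) * (1 - \<beta>\<^sup>2) = (\<beta> - \<alpha>)\<^sup>2" by algebra
  finally have "(\<beta> - \<alpha>)\<^sup>2 \<le> (x * (1 - \<alpha> * \<beta>))\<^sup>2"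
    by (simp only: power_mult_distrib)
  then have "\<beta> - \<alpha> \<le> x * (1 - \<alpha> * \<beta>)"
    by (rule power2_le_imp_le) (use x ab1 in simp)
  then have "\<beta> * (1 + \<alpha> * x) \<le> \<alpha> + x" by (simp add: algebra_simps)
  moreover have "0 < 1 + \<alpha> * x" using x \<alpha>\<beta> by (simp add: add_pos_nonneg)
  ultimately show ?thesis by (simp add: pos_le_divide_eq \<alpha>_def \<beta>_def x_def)
qed

lemma sum_roots_of_unity_power:
  assumes n: "n > 0"
  defines "\<omega> \<equiv> cis (2 * pi / real n)"
  shows "(\<Sum>l<n. (\<omega> ^ l) ^ m) = (if n dvd m then of_nat n else 0)"
proof -
  have \<omega>m: "\<omega> ^ m = exp (2 * of_real pi * \<i> * of_nat m / of_nat n)" for m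
  proof -
    have "2 * of_real pi * \<i> * of_nat m / of_nat n = of_nat m * (\<i> * complex_of_real (2 * pi / real n))"
      by simp
    then show ?thesis by (simp only: exp_of_nat_mult \<omega>_def cis_conv_exp)
  qed
  have "\<omega> ^ n = 1" unfolding \<omega>m using complex_root_unity_eq_1[of n n] n by simp
  then have one: "(\<omega> ^ m) ^ n = 1" by (metis mult.commute power_mult power_one)
  have iff: "\<omega> ^ m = 1 \<longleftrightarrow> n dvd m"
    unfolding \<omega>m using complex_root_unity_eq_1[of n m] n by simp
  have "(\<Sum>l<n. (\<omega> ^ l) ^ m) = (\<Sum>l<n. (\<omega> ^ m) ^ l)" by (simp add: mult.commute flip: power_mult)
  then show ?thesis using iff one by (simp add: sum_gp_strict)
qed

text \<open>
  Averaging \<open>f\<close> over the rotations by \<open>n\<close>-th roots of unity keeps only the coefficients whose index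
  is a multiple of \<open>n\<close>, so the first one after the constant term is \<open>c n\<close> and \<open>pick_cofactor\<close>
  applies at the origin. If the constant term has modulus one, the Moebius transformation
  degenerates; \<open>bounded_coefficient\<close> reaches that case by scaling.
\<close>

lemma bounded_coefficient_lt_one:
  fixes c :: "nat \<Rightarrow> complex"
  assumes sums: "\<And>s. s \<in> ball 0 1 \<Longrightarrow> (\<lambda>m. c m * s ^ m) sums f s"
    and le: "\<And>s. s \<in> ball 0 1 \<Longrightarrow> cmod (f s) \<le> 1" and c0: "cmod (c 0) < 1" and n: "n \<ge> 1"
  shows "cmod (c n) \<le> 1 - (cmod (c 0))\<^sup>2"
proof -
  define \<omega> where "\<omega> = cis (2 * pi / real n)"
  define g where "g s = (\<Sum>l<n. f (\<omega> ^ l * s)) / of_nat n" for s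
  define d where "d m = (if n dvd m then c m else 0)" for m
  have in_ball: "\<omega> ^ l * s \<in> ball 0 1" if "s \<in> ball 0 1" for l s
    using that by (simp add: \<omega>_def norm_mult norm_power)
  have gsums: "(\<lambda>m. d m * s ^ m) sums g s" if s: "s \<in> ball 0 1" for s
  proof -
    have "(\<lambda>m. (\<Sum>l<n. c m * (\<omega> ^ l * s) ^ m) / of_nat n) sums g s"
      unfolding g_def by (intro sums_divide sums_sum sums in_ball s)
    moreover have "(\<Sum>l<n. c m * (\<omega> ^ l * s) ^ m) / of_nat n = d m * s ^ m" for m
    proof -
      have "(\<Sum>l<n. c m * (\<omega> ^ l * s) ^ m) = c m * s ^ m * (\<Sum>l<n. (\<omega> ^ l) ^ m)"
        by (simp add: power_mult_distrib sum_distrib_left mult_ac)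
      then show ?thesis
        using n sum_roots_of_unity_power[of n m] by (simp add: \<omega>_def d_def)
    qed
    ultimately show ?thesis by simp
  qed
  have g0: "g 0 = c 0"
    using gsums[of 0] powser_sums_zero[of d] sums_unique2 by (fastforce simp: d_def)
  have hsums: "(\<lambda>m. (d m - (if m = 0 then c 0 else 0)) * s ^ m) sums (g s - c 0)"
    if "s \<in> ball 0 1" for s
  proof -
    have "(\<lambda>m. (if m = 0 then c 0 else 0) * s ^ m) sums c 0"
      using sums_single[of 0 "\<lambda>m. c 0 * s ^ m"]
      by (simp add: if_distrib[of "\<lambda>x. x * _"] cong: if_cong)
    from sums_diff[OF gsums[OF that] this] show ?thesis by (simp add: left_diff_distrib)
  qed
  obtain q where q: "q holomorphic_on ball 0 1"
    "\<And>s. s \<in> ball 0 1 \<Longrightarrow> g s - c 0 = s ^ n * q s" "q 0 = c n"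
  proof (rule power_series_factor[OF hsums, of n])
    show "d j - (if j = 0 then c 0 else 0) = 0" if "j < n" for j
      using that by (auto simp: d_def dest: dvd_imp_le)
  qed (use n in \<open>auto simp: d_def\<close>)
  have "cmod (q 0) \<le> cmod (1 - cnj (g 0) * g 0)"
  proof (rule pick_cofactor[where n = n])
    show "g holomorphic_on ball 0 1"
      using power_series_holomorphic[of 0 1 d g] gsums by simp
    show "cmod (g s) \<le> 1" if "s \<in> ball 0 1" for s
    proof -
      have "cmod (\<Sum>l<n. f (\<omega> ^ l * s)) \<le> of_nat (card {..<n}) * 1"
        using le[OF in_ball[OF that]] by (intro sum_norm_bound)
      then show ?thesis using n by (simp add: g_def norm_divide field_simps)
    qed
  qed (use q c0 g0 in auto)
  also have "1 - cnj (g 0) * g 0 = complex_of_real (1 - (cmod (c 0))\<^sup>2)"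
    using complex_norm_square[of "c 0"] by (simp add: g0 mult.commute)
  also have "cmod \<dots> = 1 - (cmod (c 0))\<^sup>2"
    unfolding norm_of_real using c0 by (simp add: power_le_one)
  finally show ?thesis using q(3) by simp
qed

lemma bounded_coefficient:
  fixes c :: "nat \<Rightarrow> complex"
  assumes sums: "\<And>s. s \<in> ball 0 1 \<Longrightarrow> (\<lambda>m. c m * s ^ m) sums f s"
    and le: "\<And>s. s \<in> ball 0 1 \<Longrightarrow> cmod (f s) \<le> 1" and n: "n \<ge> 1"
  shows "cmod (c n) \<le> 1 - (cmod (c 0))\<^sup>2"
proof -
  have "f 0 = c 0"
    using sums[of 0] powser_sums_zero[of c] sums_unique2 by fastforce
  then have c0: "cmod (c 0) \<le> 1" using le[of 0] by simp
  have main: "\<rho> * cmod (c n) \<le> 1 - (\<rho> * cmod (c 0))\<^sup>2" if \<rho>: "0 < \<rho>" "\<rho> < 1" for \<rho>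
  proof -
    have "cmod (complex_of_real \<rho> * c n) \<le> 1 - (cmod (complex_of_real \<rho> * c 0))\<^sup>2"
    proof (rule bounded_coefficient_lt_one[where f = "\<lambda>s. complex_of_real \<rho> * f s"])
      show "(\<lambda>m. complex_of_real \<rho> * c m * s ^ m) sums (complex_of_real \<rho> * f s)"
        if "s \<in> ball 0 1" for s
        using sums_mult[OF sums[OF that]] by (simp add: mult.assoc)
      show "cmod (complex_of_real \<rho> * f s) \<le> 1" if "s \<in> ball 0 1" for s
        using le[OF that] \<rho> by (simp add: norm_mult mult_le_one)
      show "cmod (complex_of_real \<rho> * c 0) < 1"
        using mult_left_le[OF c0, of \<rho>] \<rho> unfolding norm_mult norm_of_real by linarith
    qed (rule n)
    then show ?thesis using \<rho> by (simp add: norm_mult)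
  qed
  have "((\<lambda>\<rho>. 1 - (\<rho> * cmod (c 0))\<^sup>2 - \<rho> * cmod (c n)) \<longlongrightarrow>
      1 - (1 * cmod (c 0))\<^sup>2 - 1 * cmod (c n)) (at_left 1)"
    by (intro tendsto_intros)
  moreover have "\<forall>\<^sub>F \<rho> in at_left (1::real). 0 \<le> 1 - (\<rho> * cmod (c 0))\<^sup>2 - \<rho> * cmod (c n)"
    using eventually_at_left_real[of 0 1] main by (auto elim!: eventually_mono)
  ultimately have "0 \<le> 1 - (1 * cmod (c 0))\<^sup>2 - 1 * cmod (c n)"
    using tendsto_lowerbound trivial_limit_at_left_real by blast
  then show ?thesis by simp
qed

lemma schwarz_order:
  assumes sums: "\<And>s. s \<in> ball 0 1 \<Longrightarrow> (\<lambda>m. c m * s ^ m) sums h s"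
    and le: "\<And>s. s \<in> ball 0 1 \<Longrightarrow> cmod (h s) \<le> 1"
    and zero: "\<And>j. j < n \<Longrightarrow> c j = 0" and t: "t \<in> ball 0 1"
  shows "cmod (h t) \<le> cmod t ^ n"
proof -
  obtain q where q: "q holomorphic_on ball 0 1" "\<And>s. s \<in> ball 0 1 \<Longrightarrow> h s = s ^ n * q s"
    using power_series_factor[OF sums zero] by blast
  have "cmod (q t) \<le> 1"
    using le q(2) by (intro cofactor_le_one[OF q(1) _ t, of n]) auto
  then show ?thesis using q(2)[OF t] by (simp add: norm_mult norm_power mult_left_le)
qed

section \<open>Holomorphic maps between complex normed spaces\<close>

lemma functional_add: "functional \<phi> \<Longrightarrow> \<phi> (u + v) = \<phi> u + \<phi> v"
  and functional_scaleC: "functional \<phi> \<Longrightarrow> \<phi> (c *\<^sub>C v) = c * \<phi> v"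
  and functional_le_norm: "functional \<phi> \<Longrightarrow> cmod (\<phi> v) \<le> norm v"
  by (simp_all add: functional_def)

lemma functional_scaleR: "functional \<phi> \<Longrightarrow> \<phi> (r *\<^sub>R v) = r *\<^sub>R \<phi> v"
  using functional_scaleC[of \<phi> "of_real r" v] by (simp add: scaleC_of_real scaleR_conv_of_real)

lemma functional_bounded_linear: "functional \<phi> \<Longrightarrow> bounded_linear \<phi>"
  by (rule bounded_linear_intro[where K = 1])
    (simp_all add: functional_add functional_scaleR functional_le_norm)

lemma functional_diff: "functional \<phi> \<Longrightarrow> \<phi> (u - v) = \<phi> u - \<phi> v"
  using functional_bounded_linear bounded_linear.linear linear_diff by blast

text \<open>
  The vector valued Cauchy estimates and the vector valued Schwarz lemma below are obtained from
  their scalar versions in this way.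
\<close>

lemma norm_le_by_functionals:
  fixes x :: "'a::complex_normed_vector"
  assumes "\<And>\<phi>. functional \<phi> \<Longrightarrow> cmod (\<phi> x) \<le> B"
  shows "norm x \<le> B"
proof -
  obtain \<phi> where "functional \<phi>" "\<phi> x = complex_of_real (norm x)"
    using ex_norming_functional by blast
  then show ?thesis using assms[of \<phi>] by simp
qed

lemma bounded_bilinear_scaleC:
  "bounded_bilinear (scaleC :: complex \<Rightarrow> 'a::complex_normed_vector \<Rightarrow> 'a)"
proof (rule bounded_bilinear.intro)
  show "(r *\<^sub>R a) *\<^sub>C b = r *\<^sub>R (a *\<^sub>C b)" for r a and b :: 'a
    by (simp add: scaleR_conv_of_real scaleC_scaleC flip: scaleC_of_real)
  show "a *\<^sub>C (r *\<^sub>R b) = r *\<^sub>R (a *\<^sub>C b)" for r a and b :: 'a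
    by (simp add: scaleC_scaleC mult.commute flip: scaleC_of_real)
  show "\<exists>K. \<forall>a (b::'a). norm (a *\<^sub>C b) \<le> norm a * norm b * K"
    by (intro exI[of _ 1]) (simp add: norm_scaleC)
qed (simp_all add: scaleC_add_left scaleC_add_right)

lemma scaleC_one [simp]: "1 *\<^sub>C x = x" and scaleC_zero_left [simp]: "0 *\<^sub>C x = 0"
  and scaleC_zero_right [simp]: "c *\<^sub>C 0 = 0"
  using scaleC_of_real[of 1 x] scaleC_of_real[of 0 x] scaleC_scaleC[of c 0 0] norm_scaleC[of c 0]
  by simp_all

lemma scaleC_minus_right: "c *\<^sub>C (- x) = - (c *\<^sub>C x)"
  by (metis add.inverse_unique scaleC_add_right right_minus scaleC_zero_right)

lemma scaleC_diff_right: "c *\<^sub>C (x - y) = c *\<^sub>C x - c *\<^sub>C y"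
  using scaleC_add_right[of c x "- y"] by (simp add: scaleC_minus_right)

lemma scaleC_in_unit_ball: "norm e \<le> 1 \<Longrightarrow> s \<in> ball 0 1 \<Longrightarrow> s *\<^sub>C e \<in> ball 0 1"
  using mult_left_le[of "norm e" "cmod s"] by (simp add: norm_scaleC)

lemma half_ball_subset:
  fixes x y :: "'a::metric_space"
  assumes "y \<in> ball x (R/2)"
  shows "ball y (R/2) \<subseteq> ball x R"
proof
  fix z assume "z \<in> ball y (R/2)"
  then show "z \<in> ball x R" using assms dist_triangle[of x z y] by simp
qed

text \<open>
  On the domain of a holomorphic map the real Frechet derivative is complex linear.
\<close>

abbreviation cderiv :: "('a::complex_normed_vector \<Rightarrow> 'b::complex_normed_vector) \<Rightarrow> 'a \<Rightarrow> 'a \<Rightarrow> 'b" where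
  "cderiv f x \<equiv> frechet_derivative f (at x)"

lemma holomorphic_mapI:
  assumes "open S" "\<And>x. x \<in> S \<Longrightarrow> (f has_derivative L x) (at x)"
    "\<And>x c v. x \<in> S \<Longrightarrow> L x (c *\<^sub>C v) = c *\<^sub>C L x v"
  shows "holomorphic_map S f"
  using assms unfolding holomorphic_map_def by blast

lemma
  assumes "holomorphic_map S f" "x \<in> S"
  shows holomorphic_map_has_derivative: "(f has_derivative cderiv f x) (at x)"
    and cderiv_scaleC: "cderiv f x (c *\<^sub>C v) = c *\<^sub>C cderiv f x v"
    and cderiv_add: "cderiv f x (u + v) = cderiv f x u + cderiv f x v"
proof -
  obtain L where L: "(f has_derivative L) (at x)" "\<And>c v. L (c *\<^sub>C v) = c *\<^sub>C L v"
    using assms unfolding holomorphic_map_def by blast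
  then have eq: "cderiv f x = L" using frechet_derivative_at by metis
  then show "(f has_derivative cderiv f x) (at x)" "cderiv f x (c *\<^sub>C v) = c *\<^sub>C cderiv f x v"
    using L by simp_all
  show "cderiv f x (u + v) = cderiv f x u + cderiv f x v"
    unfolding eq using has_derivative_linear[OF L(1)] by (rule linear_add)
qed

lemma holomorphic_map_open: "holomorphic_map S f \<Longrightarrow> open S"
  by (simp add: holomorphic_map_def)

lemma holomorphic_map_subset: "holomorphic_map S f \<Longrightarrow> open T \<Longrightarrow> T \<subseteq> S \<Longrightarrow> holomorphic_map T f"
  unfolding holomorphic_map_def by blast

lemma holomorphic_map_diff:
  assumes "holomorphic_map S f" "holomorphic_map S g"
  shows "holomorphic_map S (\<lambda>x. f x - g x)"
    and "x \<in> S \<Longrightarrow> cderiv (\<lambda>x. f x - g x) x v = cderiv f x v - cderiv g x v"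
proof -
  have d: "((\<lambda>x. f x - g x) has_derivative (\<lambda>v. cderiv f x v - cderiv g x v)) (at x)"
    if "x \<in> S" for x
    by (intro has_derivative_diff holomorphic_map_has_derivative[OF assms(1) that]
        holomorphic_map_has_derivative[OF assms(2) that])
  show "holomorphic_map S (\<lambda>x. f x - g x)"
    by (rule holomorphic_mapI[OF holomorphic_map_open[OF assms(1)] d])
      (simp_all add: cderiv_scaleC[OF assms(1)] cderiv_scaleC[OF assms(2)] scaleC_diff_right)
  show "cderiv (\<lambda>x. f x - g x) x v = cderiv f x v - cderiv g x v" if "x \<in> S"
    using frechet_derivative_at[OF d[OF that]] by metis
qed

lemma holomorphic_map_add:
  assumes "holomorphic_map S f" "holomorphic_map S g"
  shows "holomorphic_map S (\<lambda>x. f x + g x)"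
    and "x \<in> S \<Longrightarrow> cderiv (\<lambda>x. f x + g x) x v = cderiv f x v + cderiv g x v"
proof -
  have d: "((\<lambda>x. f x + g x) has_derivative (\<lambda>v. cderiv f x v + cderiv g x v)) (at x)"
    if "x \<in> S" for x
    by (intro has_derivative_add holomorphic_map_has_derivative[OF assms(1) that]
        holomorphic_map_has_derivative[OF assms(2) that])
  show "holomorphic_map S (\<lambda>x. f x + g x)"
    by (rule holomorphic_mapI[OF holomorphic_map_open[OF assms(1)] d])
      (simp_all add: cderiv_scaleC[OF assms(1)] cderiv_scaleC[OF assms(2)] scaleC_add_right)
  show "cderiv (\<lambda>x. f x + g x) x v = cderiv f x v + cderiv g x v" if "x \<in> S"
    using frechet_derivative_at[OF d[OF that]] by metis
qed

lemma holomorphic_map_scaleC: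
  assumes "holomorphic_map S f"
  shows "holomorphic_map S (\<lambda>x. c *\<^sub>C f x)"
    and "x \<in> S \<Longrightarrow> cderiv (\<lambda>x. c *\<^sub>C f x) x v = c *\<^sub>C cderiv f x v"
proof -
  have d: "((\<lambda>x. c *\<^sub>C f x) has_derivative (\<lambda>v. c *\<^sub>C cderiv f x v)) (at x)" if "x \<in> S" for x
    by (rule bounded_linear.has_derivative[OF bounded_bilinear.bounded_linear_right[OF
          bounded_bilinear_scaleC] holomorphic_map_has_derivative[OF assms that]])
  show "holomorphic_map S (\<lambda>x. c *\<^sub>C f x)"
    by (rule holomorphic_mapI[OF holomorphic_map_open[OF assms] d])
      (simp_all add: cderiv_scaleC[OF assms] scaleC_scaleC mult.commute)
  show "cderiv (\<lambda>x. c *\<^sub>C f x) x v = c *\<^sub>C cderiv f x v" if "x \<in> S"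
    using frechet_derivative_at[OF d[OF that]] by metis
qed

lemma holomorphic_map_affine:
  assumes f: "holomorphic_map S f"
    and T: "open T" "\<And>x. x \<in> T \<Longrightarrow> b + c *\<^sub>C x \<in> S"
  shows "holomorphic_map T (\<lambda>x. f (b + c *\<^sub>C x))"
    and "x \<in> T \<Longrightarrow> cderiv (\<lambda>x. f (b + c *\<^sub>C x)) x v = c *\<^sub>C cderiv f (b + c *\<^sub>C x) v"
proof -
  have d: "((\<lambda>x. f (b + c *\<^sub>C x)) has_derivative (\<lambda>v. c *\<^sub>C cderiv f (b + c *\<^sub>C x) v)) (at x)"
    if "x \<in> T" for x
  proof -
    have "((\<lambda>x. b + c *\<^sub>C x) has_derivative (\<lambda>v. 0 + c *\<^sub>C v)) (at x)"
      by (intro has_derivative_add has_derivative_const bounded_linear_imp_has_derivative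
          bounded_bilinear.bounded_linear_right[OF bounded_bilinear_scaleC])
    from diff_chain_at[OF this holomorphic_map_has_derivative[OF f T(2)[OF that]]]
    show ?thesis by (simp add: o_def cderiv_scaleC[OF f T(2)[OF that]])
  qed
  show "holomorphic_map T (\<lambda>x. f (b + c *\<^sub>C x))"
    by (rule holomorphic_mapI[OF T(1) d])
      (simp_all add: cderiv_scaleC[OF f T(2)] scaleC_scaleC mult.commute)
  show "cderiv (\<lambda>x. f (b + c *\<^sub>C x)) x v = c *\<^sub>C cderiv f (b + c *\<^sub>C x) v" if "x \<in> T"
    using frechet_derivative_at[OF d[OF that]] by metis
qed

lemma slice_has_field_derivative:
  assumes f: "holomorphic_map S f" and \<phi>: "functional \<phi>" and x: "x + t *\<^sub>C v \<in> S"
  shows "((\<lambda>t. \<phi> (f (x + t *\<^sub>C v))) has_field_derivative \<phi> (cderiv f (x + t *\<^sub>C v) v)) (at t)"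
proof -
  have "((\<lambda>t. x + t *\<^sub>C v) has_derivative (\<lambda>s. 0 + s *\<^sub>C v)) (at t)"
    by (intro has_derivative_add has_derivative_const bounded_linear_imp_has_derivative
        bounded_bilinear.bounded_linear_left[OF bounded_bilinear_scaleC])
  from diff_chain_at[OF this holomorphic_map_has_derivative[OF f x]]
  have "((\<lambda>t. f (x + t *\<^sub>C v)) has_derivative (\<lambda>s. s *\<^sub>C cderiv f (x + t *\<^sub>C v) v)) (at t)"
    by (simp add: o_def cderiv_scaleC[OF f x])
  note bounded_linear.has_derivative[OF functional_bounded_linear[OF \<phi>] this]
  moreover have "(\<lambda>s. \<phi> (s *\<^sub>C cderiv f (x + t *\<^sub>C v) v)) = (*) (\<phi> (cderiv f (x + t *\<^sub>C v) v))"
    by (rule ext) (simp add: functional_scaleC[OF \<phi>])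
  ultimately show ?thesis unfolding has_field_derivative_def by simp
qed

lemma slice_holomorphic:
  assumes f: "holomorphic_map (ball x R) f" and \<phi>: "functional \<phi>" and R: "R > 0" and h: "r * norm h \<le> R"
  shows "(\<lambda>t. \<phi> (f (x + t *\<^sub>C h))) holomorphic_on ball 0 r"
proof -
  have "x + t *\<^sub>C h \<in> ball x R" if t: "t \<in> ball 0 r" for t
  proof (cases "h = 0")
    case True
    then show ?thesis using R by simp
  next
    case False
    then have "cmod t * norm h < r * norm h" using t by simp
    then show ?thesis using h by (simp add: norm_scaleC dist_norm)
  qed
  then show ?thesis
    unfolding holomorphic_on_open[OF open_ball]
    using slice_has_field_derivative[OF f \<phi>] by blast
qed

lemma cauchy_estimate_disc:
  assumes g: "g holomorphic_on ball 0 r" and r: "r > 0"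
    and le: "\<And>t. t \<in> ball 0 r \<Longrightarrow> cmod (g t) \<le> M"
  shows "cmod ((deriv ^^ n) g 0) \<le> fact n * M / r ^ n"
proof -
  have M: "M \<ge> 0" using le[of 0] r norm_ge_zero[of "g 0"] by (simp del: norm_ge_zero)
  have main: "cmod ((deriv ^^ n) g 0) \<le> fact n * M / \<rho> ^ n" if \<rho>: "0 < \<rho>" "\<rho> < r" for \<rho>
  proof (rule Cauchy_inequality)
    show "g holomorphic_on ball 0 \<rho>" using \<rho> by (auto intro: holomorphic_on_subset[OF g])
    show "continuous_on (cball 0 \<rho>) g"
      using \<rho> by (auto intro: continuous_on_subset[OF holomorphic_on_imp_continuous_on[OF g]])
  qed (use \<rho> le in auto)
  have "((\<lambda>\<rho>. fact n * M / \<rho> ^ n) \<longlongrightarrow> fact n * M / r ^ n) (at_left r)"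
    using r by (intro tendsto_intros) auto
  moreover have "\<forall>\<^sub>F \<rho> in at_left r. cmod ((deriv ^^ n) g 0) \<le> fact n * M / \<rho> ^ n"
    using eventually_at_left_real[OF r] main by (auto elim!: eventually_mono)
  ultimately show ?thesis using tendsto_lowerbound trivial_limit_at_left_real by blast
qed

text \<open>
  The remainder is the tail of the Taylor series at the point \<open>1\<close>; Cauchy's estimates bound it by a
  geometric series, and \<open>r \<ge> 2\<close> bounds the sum of that series by twice its first term.
\<close>

lemma linear_remainder_disc:
  assumes g: "g holomorphic_on ball 0 r" and r: "r \<ge> 2"
    and le: "\<And>t. t \<in> ball 0 r \<Longrightarrow> cmod (g t) \<le> M"
  shows "cmod (g 1 - g 0 - deriv g 0) \<le> 2 * M / r\<^sup>2"
proof -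
  define c where "c m = (deriv ^^ m) g 0 / fact m" for m
  have c: "cmod (c m) \<le> M * (1 / r) ^ m" for m
    using cauchy_estimate_disc[OF g _ le, of m] r
    by (simp add: c_def norm_divide field_simps)
  have "(\<lambda>m. c m * (1 - 0) ^ m) sums g 1"
    unfolding c_def using r by (intro holomorphic_power_series[OF g]) auto
  then have "c sums g 1" by simp
  then have tail: "(\<lambda>m. c (m + 2)) sums (g 1 - (\<Sum>m<2. c m))"
    by (rule sums_split_initial_segment)
  have geo: "(\<lambda>m. M * (1 / r) ^ 2 * (1 / r) ^ m) sums (M * (1 / r) ^ 2 * (1 / (1 - 1 / r)))"
    using r by (intro sums_mult geometric_sums) simp
  have "cmod (suminf (\<lambda>m. c (m + 2))) \<le> suminf (\<lambda>m. M * (1 / r) ^ 2 * (1 / r) ^ m)"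
  proof (rule norm_suminf_le)
    show "cmod (c (m + 2)) \<le> M * (1 / r) ^ 2 * (1 / r) ^ m" for m
      using c[of "m + 2"] unfolding power_add by (simp only: mult_ac)
  qed (rule sums_summable[OF geo])
  then have "cmod (g 1 - (\<Sum>m<2. c m)) \<le> M * (1 / r) ^ 2 * (1 / (1 - 1 / r))"
    using sums_unique[OF tail] sums_unique[OF geo] by simp
  also have "(\<Sum>m<2. c m) = g 0 + deriv g 0" by (simp add: c_def numeral_2_eq_2)
  also have "M * (1 / r) ^ 2 * (1 / (1 - 1 / r)) \<le> M * (1 / r) ^ 2 * 2"
  proof (rule mult_left_mono)
    show "1 / (1 - 1 / r) \<le> 2" using r by (simp add: field_simps)
    have "M \<ge> 0" using le[of 0] r norm_ge_zero[of "g 0"] by (simp del: norm_ge_zero)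
    then show "0 \<le> M * (1 / r) ^ 2" by simp
  qed
  finally show ?thesis by (simp add: power_divide algebra_simps)
qed

lemma cauchy_estimate:
  fixes f :: "'a::complex_normed_vector \<Rightarrow> 'b::complex_normed_vector"
  assumes f: "holomorphic_map (ball x R) f" and R: "R > 0"
    and M: "\<And>y. y \<in> ball x R \<Longrightarrow> norm (f y) \<le> M"
  shows "norm (cderiv f x h) \<le> M / R * norm h"
proof (cases "h = 0")
  case True
  then show ?thesis using cderiv_scaleC[OF f, of x 0 0] R by simp
next
  case False
  show ?thesis
  proof (rule norm_le_by_functionals)
    fix \<phi> :: "'b \<Rightarrow> complex" assume \<phi>: "functional \<phi>"
    define r where "r = R / norm h"
    have r: "r > 0" "r * norm h \<le> R" using R False by (simp_all add: r_def)
    define g where "g t = \<phi> (f (x + t *\<^sub>C h))" for t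
    have g: "g holomorphic_on ball 0 r"
      unfolding g_def by (rule slice_holomorphic[OF f \<phi> R r(2)])
    have "cmod (g t) \<le> M" if "t \<in> ball 0 r" for t
    proof -
      have "x + t *\<^sub>C h \<in> ball x R"
        using that False by (simp add: dist_norm norm_scaleC r_def field_simps)
      then show ?thesis unfolding g_def using M functional_le_norm[OF \<phi>] order_trans by blast
    qed
    then have "cmod (deriv g 0) \<le> M / r"
      using cauchy_estimate_disc[OF g r(1), of M 1] by simp
    moreover have "deriv g 0 = \<phi> (cderiv f x h)"
      using slice_has_field_derivative[OF f \<phi>, of x 0 h] R
      unfolding g_def by (intro DERIV_imp_deriv) simp
    ultimately show "cmod (\<phi> (cderiv f x h)) \<le> M / R * norm h"
      using False by (simp add: r_def)
  qed
qed

text \<open>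
  The quadratic remainder with a constant that depends only on a bound of \<open>f\<close> is what makes the
  convergence of difference quotients, and later the differentiability of multilinear derivatives,
  uniform.
\<close>

lemma linear_remainder:
  fixes f :: "'a::complex_normed_vector \<Rightarrow> 'b::complex_normed_vector"
  assumes f: "holomorphic_map (ball x R) f" and R: "R > 0"
    and M: "\<And>y. y \<in> ball x R \<Longrightarrow> norm (f y) \<le> M" and h: "norm h \<le> R / 2"
  shows "norm (f (x + h) - f x - cderiv f x h) \<le> 2 * M / R\<^sup>2 * (norm h)\<^sup>2"
proof (cases "h = 0")
  case True
  then show ?thesis using cderiv_scaleC[OF f, of x 0 0] R by simp
next
  case False
  show ?thesis
  proof (rule norm_le_by_functionals)
    fix \<phi> :: "'b \<Rightarrow> complex" assume \<phi>: "functional \<phi>"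
    define r where "r = R / norm h"
    have r: "r \<ge> 2" "r * norm h \<le> R" using R False h by (simp_all add: r_def field_simps)
    define g where "g t = \<phi> (f (x + t *\<^sub>C h))" for t
    have g: "g holomorphic_on ball 0 r"
      unfolding g_def by (rule slice_holomorphic[OF f \<phi> R r(2)])
    have "cmod (g t) \<le> M" if "t \<in> ball 0 r" for t
    proof -
      have "x + t *\<^sub>C h \<in> ball x R"
        using that False by (simp add: dist_norm norm_scaleC r_def field_simps)
      then show ?thesis unfolding g_def using M functional_le_norm[OF \<phi>] order_trans by blast
    qed
    then have "cmod (g 1 - g 0 - deriv g 0) \<le> 2 * M / r\<^sup>2"
      by (rule linear_remainder_disc[OF g r(1)])
    moreover have "deriv g 0 = \<phi> (cderiv f x h)"
      using slice_has_field_derivative[OF f \<phi>, of x 0 h] R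
      unfolding g_def by (intro DERIV_imp_deriv) simp
    ultimately show "cmod (\<phi> (f (x + h) - f x - cderiv f x h)) \<le> 2 * M / R\<^sup>2 * (norm h)\<^sup>2"
      using False by (simp add: r_def g_def functional_diff[OF \<phi>] power_divide)
  qed
qed

lemma holomorphic_map_locally_bounded:
  assumes f: "holomorphic_map S f" and x: "x \<in> S"
  obtains R M where "R > 0" "ball x R \<subseteq> S" "\<And>y. y \<in> ball x R \<Longrightarrow> norm (f y) \<le> M"
proof -
  obtain R1 where R1: "R1 > 0" "ball x R1 \<subseteq> S"
    using holomorphic_map_open[OF f] x open_contains_ball by blast
  have "isCont f x" using holomorphic_map_has_derivative[OF f x] has_derivative_continuous by blast
  then obtain R2 where R2: "R2 > 0" "\<And>y. dist y x < R2 \<Longrightarrow> dist (f y) (f x) < 1"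
    unfolding continuous_at_eps_delta by (metis zero_less_one)
  show ?thesis
  proof
    show "min R1 R2 > 0" "ball x (min R1 R2) \<subseteq> S" using R1 R2 by auto
    show "norm (f y) \<le> norm (f x) + 1" if "y \<in> ball x (min R1 R2)" for y
    proof -
      have "norm (f y - f x) < 1" using R2(2)[of y] that by (simp add: dist_norm norm_minus_commute)
      then show ?thesis using norm_triangle_sub[of "f y" "f x"] by linarith
    qed
  qed
qed

text \<open>
  Weierstrass' theorem. By Cauchy's estimate the derivatives form a uniform Cauchy sequence on a
  smaller ball; completeness of the target space provides their limit.
\<close>

lemma holomorphic_map_uniform_limit:
  fixes f :: "nat \<Rightarrow> 'a::complex_normed_vector \<Rightarrow> 'b::complex_banach"
  assumes f: "\<And>n. holomorphic_map (ball x R) (f n)" and R: "R > 0"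
    and lim: "uniform_limit (ball x R) f g sequentially"
  shows "\<exists>L. (g has_derivative L) (at x) \<and> (\<forall>c v. L (c *\<^sub>C v) = c *\<^sub>C L v)"
proof -
  have x: "x \<in> ball x (R/2)" and y2: "y \<in> ball x (R/2) \<Longrightarrow> y \<in> ball x R" for y using R by auto
  have diff: "norm (cderiv (f n) y h - cderiv (f m) y h) \<le> e / (R/2) * norm h"
    if y: "y \<in> ball x (R/2)" and e: "\<And>y. y \<in> ball x R \<Longrightarrow> norm (f n y - f m y) \<le> e" for n m y h e
  proof -
    have sub: "ball y (R/2) \<subseteq> ball x R" using y by (rule half_ball_subset)
    have "norm (cderiv (\<lambda>y. f n y - f m y) y h) \<le> e / (R/2) * norm h"
    proof (rule cauchy_estimate)
      show "holomorphic_map (ball y (R/2)) (\<lambda>y. f n y - f m y)"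
        by (rule holomorphic_map_subset[OF holomorphic_map_diff(1)[OF f f] open_ball sub])
    qed (use R e sub in auto)
    then show ?thesis using holomorphic_map_diff(2)[OF f f y2[OF y]] by simp
  qed
  have cauchy: "\<exists>N. \<forall>n\<ge>N. \<forall>m\<ge>N. \<forall>y\<in>ball x (R/2). \<forall>h. norm (cderiv (f n) y h - cderiv (f m) y h) \<le> e * norm h"
    if e: "e > 0" for e
  proof -
    have e': "0 < e * (R/2)/2" using e R by simp
    from uniform_limitD[OF lim e'] obtain N where
      N: "\<And>n y. n \<ge> N \<Longrightarrow> y \<in> ball x R \<Longrightarrow> dist (f n y) (g y) < e * (R/2)/2"
      unfolding eventually_sequentially by blast
    show ?thesis
    proof (intro exI[of _ N] allI impI ballI)
      fix n m y h assume "N \<le> n" "N \<le> m" and y: "y \<in> ball x (R/2)"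
      have "norm (f n y - f m y) \<le> e * (R/2)" if "y \<in> ball x R" for y
        using N[OF \<open>N \<le> n\<close> that] N[OF \<open>N \<le> m\<close> that]
          dist_triangle2[of "f n y" "f m y" "g y"] by (simp add: dist_norm)
      from diff[OF y this] show "norm (cderiv (f n) y h - cderiv (f m) y h) \<le> e * norm h"
        using R by simp
    qed
  qed
  have conv: "\<exists>l. (\<lambda>n. cderiv (f n) y h) \<longlonglongrightarrow> l" if y: "y \<in> ball x (R/2)" for y h
  proof (rule Cauchy_convergent[unfolded convergent_def], rule CauchyI)
    fix e :: real assume "e > 0"
    then have "0 < e / (norm h + 1)" by (simp add: add_nonneg_pos)
    then obtain N where N: "\<forall>n\<ge>N. \<forall>m\<ge>N. norm (cderiv (f n) y h - cderiv (f m) y h) \<le> e / (norm h + 1) * norm h"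
      using cauchy y by meson
    moreover have "e / (norm h + 1) * norm h < e"
      using \<open>e > 0\<close> by (simp add: pos_divide_less_eq add_pos_nonneg add.commute ring_distribs)
    ultimately show "\<exists>M. \<forall>m\<ge>M. \<forall>n\<ge>M. norm (cderiv (f m) y h - cderiv (f n) y h) < e"
      by (meson le_less_trans)
  qed
  define L where "L y h = lim (\<lambda>n. cderiv (f n) y h)" for y h
  have L: "(\<lambda>n. cderiv (f n) y h) \<longlonglongrightarrow> L y h" if "y \<in> ball x (R/2)" for y h
    using conv[OF that, of h] unfolding L_def by (metis limI)
  have "\<exists>g'. \<forall>y\<in>ball x (R/2). (\<lambda>n. f n y) \<longlonglongrightarrow> g' y \<and> (g' has_derivative L y) (at y within ball x (R/2))"
  proof (rule has_derivative_sequence)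
    show "(f n has_derivative cderiv (f n) y) (at y within ball x (R/2))" if "y \<in> ball x (R/2)" for n y
      using holomorphic_map_has_derivative[OF f y2[OF that]] has_derivative_at_withinI by blast
    fix e :: real assume e: "e > 0"
    then obtain N where N: "\<And>n m y h. n \<ge> N \<Longrightarrow> m \<ge> N \<Longrightarrow> y \<in> ball x (R/2) \<Longrightarrow> norm (cderiv (f n) y h - cderiv (f m) y h) \<le> e * norm h"
      using cauchy by meson
    have "norm (cderiv (f n) y h - L y h) \<le> e * norm h" if n: "n \<ge> N" and y: "y \<in> ball x (R/2)" for n y h
    proof (rule tendsto_upperbound)
      show "(\<lambda>m. norm (cderiv (f n) y h - cderiv (f m) y h)) \<longlonglongrightarrow> norm (cderiv (f n) y h - L y h)"
        by (intro tendsto_intros L y)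
      show "\<forall>\<^sub>F m in sequentially. norm (cderiv (f n) y h - cderiv (f m) y h) \<le> e * norm h"
        using N[OF n _ y] unfolding eventually_sequentially by blast
    qed simp
    then show "\<forall>\<^sub>F n in sequentially. \<forall>y\<in>ball x (R/2). \<forall>h. norm (cderiv (f n) y h - L y h) \<le> e * norm h"
      unfolding eventually_sequentially by blast
  next
    show "(\<lambda>n. f n x) \<longlonglongrightarrow> g x" using tendsto_uniform_limitI[OF lim] R by simp
  qed (use x in auto)
  then obtain g' where g': "\<And>y. y \<in> ball x (R/2) \<Longrightarrow> (\<lambda>n. f n y) \<longlonglongrightarrow> g' y"
    "(g' has_derivative L x) (at x within ball x (R/2))" using x by blast
  have "g' y = g y" if "y \<in> ball x (R/2)" for y
    using g'(1)[OF that] tendsto_uniform_limitI[OF lim y2[OF that]] LIMSEQ_unique by blast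
  then have "(g has_derivative L x) (at x within ball x (R/2))"
    using has_derivative_transform[OF x _ g'(2)] by metis
  then have "(g has_derivative L x) (at x)" using x at_within_open[OF x open_ball] by simp
  moreover have "L x (c *\<^sub>C v) = c *\<^sub>C L x v" for c v
  proof -
    have "(\<lambda>n. c *\<^sub>C cderiv (f n) x v) \<longlonglongrightarrow> c *\<^sub>C L x v"
      by (rule bounded_linear.tendsto[OF bounded_bilinear.bounded_linear_right[OF bounded_bilinear_scaleC] L[OF x]])
    moreover have "c *\<^sub>C cderiv (f n) x v = cderiv (f n) x (c *\<^sub>C v)" for n
      using cderiv_scaleC[OF f y2[OF x]] by simp
    ultimately have "(\<lambda>n. cderiv (f n) x (c *\<^sub>C v)) \<longlonglongrightarrow> c *\<^sub>C L x v" by simp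
    then show ?thesis by (rule LIMSEQ_unique[OF L[OF x]])
  qed
  ultimately show ?thesis by blast
qed

text \<open>
  The difference quotients in direction \<open>u\<close> are holomorphic and, by the quadratic remainder
  estimate, converge locally uniformly to the directional derivative.
\<close>

lemma holomorphic_map_cderiv:
  fixes f :: "'a::complex_normed_vector \<Rightarrow> 'b::complex_banach"
  assumes f: "holomorphic_map S f"
  shows "holomorphic_map S (\<lambda>x. cderiv f x u)"
  unfolding holomorphic_map_def
proof (intro conjI ballI holomorphic_map_open[OF f])
  fix x assume "x \<in> S"
  from holomorphic_map_locally_bounded[OF f this] obtain R M
    where R: "R > 0" "ball x R \<subseteq> S" and M: "\<And>y. y \<in> ball x R \<Longrightarrow> norm (f y) \<le> M" by blast
  note sub = half_ball_subset[of _ x R]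
  obtain N0 :: nat where N0: "norm u / (R/4) \<le> real N0" using real_arch_simple by blast
  \<comment> \<open>The offset \<open>N0\<close> keeps all translates \<open>y + s n *\<^sub>R u\<close> within the ball on which \<open>f\<close> is bounded.\<close>
  define s where "s n = 1 / real (N0 + Suc n)" for n
  have s0: "s n > 0" for n by (simp add: s_def)
  have su: "s n * norm u \<le> R/4" for n
  proof -
    have "norm u \<le> real N0 * (R/4)" using N0 R by (simp add: field_simps)
    also have "\<dots> \<le> real (N0 + Suc n) * (R/4)" using R by (intro mult_right_mono) auto
    finally show ?thesis by (simp add: s_def field_simps)
  qed
  have slim: "s \<longlonglongrightarrow> 0"
    unfolding s_def using LIMSEQ_ignore_initial_segment[OF lim_inverse_n', of "Suc N0"]
    by (simp add: add.commute)
  define g where "g n y = complex_of_real (1 / s n) *\<^sub>C (f (s n *\<^sub>R u + 1 *\<^sub>C y) - f y)" for n y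
  have "uniform_limit (ball x (R/2)) g (\<lambda>y. cderiv f y u) sequentially"
  proof (rule uniform_limitI)
    fix e :: real assume e: "e > 0"
    have "(\<lambda>n. 2 * M / (R/2)\<^sup>2 * (norm u)\<^sup>2 * s n) \<longlonglongrightarrow> 2 * M / (R/2)\<^sup>2 * (norm u)\<^sup>2 * 0"
      by (intro tendsto_intros slim)
    then have "\<forall>\<^sub>F n in sequentially. 2 * M / (R/2)\<^sup>2 * (norm u)\<^sup>2 * s n < e"
      using e by (intro order_tendstoD) auto
    then show "\<forall>\<^sub>F n in sequentially. \<forall>y\<in>ball x (R/2). dist (g n y) (cderiv f y u) < e"
    proof (eventually_elim, intro ballI)
      fix n y assume n: "2 * M / (R/2)\<^sup>2 * (norm u)\<^sup>2 * s n < e" and y: "y \<in> ball x (R/2)"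
      have holo: "holomorphic_map (ball y (R/2)) f"
        using holomorphic_map_subset[OF f open_ball] sub[OF y] R by blast
      have "norm (f (y + s n *\<^sub>R u) - f y - cderiv f y (s n *\<^sub>R u)) \<le> 2 * M / (R/2)\<^sup>2 * (norm (s n *\<^sub>R u))\<^sup>2"
        by (rule linear_remainder[OF holo]) (use R M sub[OF y] su[of n] s0[of n] in auto)
      also have "cderiv f y (s n *\<^sub>R u) = complex_of_real (s n) *\<^sub>C cderiv f y u"
        using cderiv_scaleC[OF holo, of y] R by (simp flip: scaleC_of_real)
      finally have le: "norm (f (y + s n *\<^sub>R u) - f y - complex_of_real (s n) *\<^sub>C cderiv f y u)
          \<le> 2 * M / (R/2)\<^sup>2 * (norm u)\<^sup>2 * (s n)\<^sup>2" using s0[of n] by (simp add: power_mult_distrib mult_ac)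
      have "g n y - cderiv f y u = complex_of_real (1 / s n) *\<^sub>C
          (f (y + s n *\<^sub>R u) - f y - complex_of_real (s n) *\<^sub>C cderiv f y u)"
        using s0[of n] by (simp add: g_def scaleC_diff_right scaleC_scaleC add.commute flip: of_real_mult)
      then have "norm (g n y - cderiv f y u) =
          norm (f (y + s n *\<^sub>R u) - f y - complex_of_real (s n) *\<^sub>C cderiv f y u) / s n"
        using s0[of n] by (simp add: norm_scaleC norm_divide)
      also have "\<dots> \<le> 2 * M / (R/2)\<^sup>2 * (norm u)\<^sup>2 * s n"
        using divide_right_mono[OF le, of "s n"] s0[of n] by (simp add: power2_eq_square)
      finally show "dist (g n y) (cderiv f y u) < e" using n by (simp add: dist_norm)
    qed
  qed
  moreover have "holomorphic_map (ball x (R/2)) (g n)" for n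
    unfolding g_def
  proof (intro holomorphic_map_scaleC(1) holomorphic_map_diff(1) holomorphic_map_affine(1)[OF f] open_ball)
    show "holomorphic_map (ball x (R/2)) f"
      using R by (intro holomorphic_map_subset[OF f]) auto
    fix y assume y: "y \<in> ball x (R/2)"
    have "s n *\<^sub>R u + 1 *\<^sub>C y \<in> ball y (R/2)"
      using su[of n] s0[of n] R by (simp add: dist_norm)
    then show "s n *\<^sub>R u + 1 *\<^sub>C y \<in> S" using sub[OF y] R(2) by blast
  qed
  ultimately show "\<exists>L. ((\<lambda>x. cderiv f x u) has_derivative L) (at x) \<and> (\<forall>c v. L (c *\<^sub>C v) = c *\<^sub>C L v)"
    using R(1) by (intro holomorphic_map_uniform_limit[where f = g and R = "R/2"]) auto
qed

section \<open>Higher Frechet derivatives\<close>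

text \<open>
  Iterated directional derivatives. Since each is taken with the other arguments fixed, this
  recursion involves derivatives of maps into the target space only, never of maps into a space of
  multilinear maps. The first list entry is the direction of the last differentiation, and lists of
  the wrong length give \<open>0\<close>, as for \<^const>\<open>bounded_multilinear\<close>.
\<close>

primrec iter_deriv ::
  "nat \<Rightarrow> ('a::complex_normed_vector \<Rightarrow> 'b::complex_normed_vector) \<Rightarrow> 'a \<Rightarrow> 'a list \<Rightarrow> 'b" where
  "iter_deriv 0 f = (\<lambda>x vs. if vs = [] then f x else 0)"
| "iter_deriv (Suc n) f = (\<lambda>x vs. case vs of [] \<Rightarrow> 0
     | u # ws \<Rightarrow> if length ws = n then cderiv (\<lambda>y. iter_deriv n f y ws) x u else 0)"

lemma iter_deriv_wrong_length: "length vs \<noteq> n \<Longrightarrow> iter_deriv n f x vs = 0"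
  by (cases n) (auto split: list.split)

lemma holomorphic_iter_deriv:
  fixes f :: "'a::complex_normed_vector \<Rightarrow> 'b::complex_banach"
  assumes f: "holomorphic_map S f"
  shows "length vs = n \<Longrightarrow> holomorphic_map S (\<lambda>x. iter_deriv n f x vs)"
proof (induction n arbitrary: vs)
  case 0
  then show ?case using f by simp
next
  case (Suc n)
  then obtain u ws where "vs = u # ws" "length ws = n" by (auto simp: length_Suc_conv)
  then show ?case using holomorphic_map_cderiv[OF Suc.IH] by simp
qed

lemma cderiv_cong:
  assumes f: "holomorphic_map S f" and eq: "\<And>y. y \<in> S \<Longrightarrow> f y = g y" and x: "x \<in> S"
  shows "cderiv f x = cderiv g x"
proof -
  have "(g has_derivative cderiv f x) (at x)"
    by (rule has_derivative_transform_within_open[OF holomorphic_map_has_derivative[OF f x]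
          holomorphic_map_open[OF f] x eq])
  then show ?thesis by (rule frechet_derivative_at)
qed

lemma iter_deriv_add:
  fixes f :: "'a::complex_normed_vector \<Rightarrow> 'b::complex_banach"
  assumes f: "holomorphic_map S f"
  shows "x \<in> S \<Longrightarrow> length us + length ws + 1 = n \<Longrightarrow>
    iter_deriv n f x (us @ (a + b) # ws) = iter_deriv n f x (us @ a # ws) + iter_deriv n f x (us @ b # ws)"
proof (induction n arbitrary: x us)
  case (Suc n)
  show ?case
  proof (cases us)
    case Nil
    then show ?thesis
      using cderiv_add[OF holomorphic_iter_deriv[OF f] Suc.prems(1)] Suc.prems(2) by simp
  next
    case (Cons u us')
    then have len: "length us' + length ws + 1 = n" using Suc.prems by simp
    have holo: "holomorphic_map S (\<lambda>y. iter_deriv n f y (us' @ c # ws))" for c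
      using len by (intro holomorphic_iter_deriv[OF f]) simp
    have "cderiv (\<lambda>y. iter_deriv n f y (us' @ (a + b) # ws)) x =
        cderiv (\<lambda>y. iter_deriv n f y (us' @ a # ws) + iter_deriv n f y (us' @ b # ws)) x"
      by (rule cderiv_cong[OF holo Suc.IH[OF _ len] Suc.prems(1)])
    then show ?thesis
      using len Suc.prems(1) by (simp add: Cons holomorphic_map_add(2)[OF holo holo])
  qed
qed simp

lemma iter_deriv_scaleC:
  fixes f :: "'a::complex_normed_vector \<Rightarrow> 'b::complex_banach"
  assumes f: "holomorphic_map S f"
  shows "x \<in> S \<Longrightarrow> length us + length ws + 1 = n \<Longrightarrow>
    iter_deriv n f x (us @ (c *\<^sub>C a) # ws) = c *\<^sub>C iter_deriv n f x (us @ a # ws)"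
proof (induction n arbitrary: x us)
  case (Suc n)
  show ?case
  proof (cases us)
    case Nil
    then show ?thesis
      using cderiv_scaleC[OF holomorphic_iter_deriv[OF f] Suc.prems(1)] Suc.prems(2) by simp
  next
    case (Cons u us')
    then have len: "length us' + length ws + 1 = n" using Suc.prems by simp
    have holo: "holomorphic_map S (\<lambda>y. iter_deriv n f y (us' @ c # ws))" for c
      using len by (intro holomorphic_iter_deriv[OF f]) simp
    have "cderiv (\<lambda>y. iter_deriv n f y (us' @ (c *\<^sub>C a) # ws)) x =
        cderiv (\<lambda>y. c *\<^sub>C iter_deriv n f y (us' @ a # ws)) x"
      by (rule cderiv_cong[OF holo Suc.IH[OF _ len] Suc.prems(1)])
    then show ?thesis
      using len Suc.prems(1) by (simp add: Cons holomorphic_map_scaleC(2)[OF holo])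
  qed
qed simp

text \<open>
  Cauchy's estimate bounds each further derivative on a ball of half the radius, with a constant
  that does not depend on the arguments. This is the boundedness of the multilinear maps, and it
  also gives the uniform differentiability below.
\<close>

lemma iter_deriv_locally_bounded:
  fixes f :: "'a::complex_normed_vector \<Rightarrow> 'b::complex_banach"
  assumes f: "holomorphic_map S f" and x: "x \<in> S"
  shows "\<exists>R M. R > 0 \<and> ball x R \<subseteq> S \<and> (\<forall>y\<in>ball x R. \<forall>vs. length vs = n \<longrightarrow>
    norm (iter_deriv n f y vs) \<le> M * prod_list (map norm vs))"
proof (induction n)
  case 0
  obtain R M where "R > 0" "ball x R \<subseteq> S" "\<And>y. y \<in> ball x R \<Longrightarrow> norm (f y) \<le> M"
    using holomorphic_map_locally_bounded[OF f x] by blast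
  then show ?case by - (rule exI[of _ R], rule exI[of _ M], simp)
next
  case (Suc n)
  then obtain R M where R: "R > 0" "ball x R \<subseteq> S" and
    M: "\<And>y vs. y \<in> ball x R \<Longrightarrow> length vs = n \<Longrightarrow> norm (iter_deriv n f y vs) \<le> M * prod_list (map norm vs)"
    by blast
  show ?case
  proof (rule exI[of _ "R/2"], rule exI[of _ "M / (R/2)"], intro conjI ballI allI impI)
    fix y and vs :: "'a list" assume y: "y \<in> ball x (R/2)" and "length vs = Suc n"
    then obtain u ws where vs: "vs = u # ws" "length ws = n" by (auto simp: length_Suc_conv)
    have sub: "ball y (R/2) \<subseteq> ball x R" using y by (rule half_ball_subset)
    have "norm (cderiv (\<lambda>y. iter_deriv n f y ws) y u) \<le> M * prod_list (map norm ws) / (R/2) * norm u"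
    proof (rule cauchy_estimate[where f = "\<lambda>y. iter_deriv n f y ws"])
      show "holomorphic_map (ball y (R/2)) (\<lambda>y. iter_deriv n f y ws)"
        using sub R by (intro holomorphic_map_subset[OF holomorphic_iter_deriv[OF f vs(2)]]) auto
    qed (use R M vs sub in auto)
    then show "norm (iter_deriv (Suc n) f y vs) \<le> M / (R/2) * prod_list (map norm vs)"
      by (simp add: vs mult_ac)
  qed (use R in auto)
qed

lemma bounded_multilinear_iter_deriv:
  fixes f :: "'a::complex_normed_vector \<Rightarrow> 'b::complex_banach"
  assumes f: "holomorphic_map S f" and x: "x \<in> S"
  shows "bounded_multilinear n (iter_deriv n f x)"
proof -
  obtain R M where "R > 0" "\<forall>y\<in>ball x R. \<forall>vs. length vs = n \<longrightarrow>
    norm (iter_deriv n f y vs) \<le> M * prod_list (map norm vs)"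
    using iter_deriv_locally_bounded[OF f x, where n = n] by blast
  then have "\<exists>C. \<forall>vs. length vs = n \<longrightarrow> norm (iter_deriv n f x vs) \<le> C * prod_list (map norm vs)"
    by (intro exI[of _ M]) simp
  then show ?thesis
    unfolding bounded_multilinear_def
    by (intro conjI allI impI iter_deriv_add[OF f x] iter_deriv_scaleC[OF f x] iter_deriv_wrong_length)
qed

lemma prod_list_norm_nonneg: "0 \<le> prod_list (map norm (vs :: 'a::real_normed_vector list))"
  by (induction vs) auto

text \<open>
  The quadratic remainder estimate is applied with the other arguments fixed. The bound of the
  differentiated map, and with it the remainder, is proportional to the product of their norms.
\<close>

lemma iter_deriv_has_multilinear_derivative:
  fixes f :: "'a::complex_normed_vector \<Rightarrow> 'b::complex_banach"
  assumes f: "holomorphic_map S f" and x: "x \<in> S"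
  shows "has_multilinear_derivative n (iter_deriv n f) (iter_deriv (Suc n) f x) x"
  unfolding has_multilinear_derivative_def
proof (intro conjI allI impI)
  show "bounded_multilinear (Suc n) (iter_deriv (Suc n) f x)"
    by (rule bounded_multilinear_iter_deriv[OF f x])
  fix e :: real assume e: "e > 0"
  obtain R M where R: "R > 0" "ball x R \<subseteq> S" and
    M: "\<And>y vs. y \<in> ball x R \<Longrightarrow> length vs = n \<Longrightarrow> norm (iter_deriv n f y vs) \<le> M * prod_list (map norm vs)"
    using iter_deriv_locally_bounded[OF f x, where n = n] by blast
  have "((\<lambda>y. 2 * M / R\<^sup>2 * norm (y - x)) \<longlongrightarrow> 2 * M / R\<^sup>2 * norm (x - x)) (at x)"
    by (intro tendsto_intros)
  then have "\<forall>\<^sub>F y in at x. 2 * M / R\<^sup>2 * norm (y - x) < e"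
    using e by (intro order_tendstoD) auto
  moreover have "\<forall>\<^sub>F y in at x. norm (y - x) \<le> R/2"
    unfolding eventually_at using R by (intro exI[of _ "R/2"]) (auto simp: dist_norm)
  ultimately show "\<forall>\<^sub>F y in at x. \<forall>vs. length vs = n \<longrightarrow>
    norm (iter_deriv n f y vs - iter_deriv n f x vs - iter_deriv (Suc n) f x ((y - x) # vs))
      \<le> e * norm (y - x) * prod_list (map norm vs)"
  proof (eventually_elim, intro allI impI)
    fix y and vs :: "'a list"
    assume small: "2 * M / R\<^sup>2 * norm (y - x) < e" and h: "norm (y - x) \<le> R/2" and vs: "length vs = n"
    have "norm (iter_deriv n f (x + (y - x)) vs - iter_deriv n f x vs - cderiv (\<lambda>y. iter_deriv n f y vs) x (y - x))
        \<le> 2 * (M * prod_list (map norm vs)) / R\<^sup>2 * (norm (y - x))\<^sup>2"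
    proof (rule linear_remainder[where f = "\<lambda>y. iter_deriv n f y vs"])
      show "holomorphic_map (ball x R) (\<lambda>y. iter_deriv n f y vs)"
        using R by (intro holomorphic_map_subset[OF holomorphic_iter_deriv[OF f vs]]) auto
    qed (use R M vs h in auto)
    also have "\<dots> = (2 * M / R\<^sup>2 * norm (y - x)) * (norm (y - x) * prod_list (map norm vs))"
      by (simp add: power2_eq_square)
    also have "\<dots> \<le> e * (norm (y - x) * prod_list (map norm vs))"
      using small prod_list_norm_nonneg[of vs] by (intro mult_right_mono) auto
    finally show "norm (iter_deriv n f y vs - iter_deriv n f x vs - iter_deriv (Suc n) f x ((y - x) # vs))
      \<le> e * norm (y - x) * prod_list (map norm vs)"
      by (simp add: vs mult.assoc)
  qed
qed

text \<open>
  Uniqueness justifies the definite description in \<^const>\<open>nth_frechet\<close>. Two derivatives are compared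
  in direction \<open>v\<close> along small multiples of \<open>v\<close>, where both approximate the same increment of \<open>G\<close>.
\<close>

lemma has_multilinear_derivative_unique:
  fixes L L' :: "'a::complex_normed_vector list \<Rightarrow> 'b::complex_normed_vector"
  assumes L: "has_multilinear_derivative n G L x" and L': "has_multilinear_derivative n G L' x"
  shows "L = L'"
proof
  fix vs :: "'a list"
  have hom: "K ((c *\<^sub>C v) # ws) = c *\<^sub>C K (v # ws)"
    if "has_multilinear_derivative n G K x" "length ws = n" for K :: "'a list \<Rightarrow> 'b" and c v ws
  proof -
    have "\<forall>us ws c v. length us + length ws + 1 = Suc n \<longrightarrow>
        K (us @ (c *\<^sub>C v) # ws) = c *\<^sub>C K (us @ v # ws)"
      using that(1) unfolding has_multilinear_derivative_def bounded_multilinear_def by blast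
    from this[rule_format, of "[]" ws c v] show ?thesis using that(2) by simp
  qed
  have ev: "\<forall>\<^sub>F y in at x. norm (G y ws - G x ws - K ((y - x) # ws)) \<le> e * norm (y - x) * prod_list (map norm ws)"
    if "has_multilinear_derivative n G K x" "e > 0" "length ws = n" for K :: "'a list \<Rightarrow> 'b" and e ws
  proof -
    have "\<forall>\<^sub>F y in at x. \<forall>vs. length vs = n \<longrightarrow>
        norm (G y vs - G x vs - K ((y - x) # vs)) \<le> e * norm (y - x) * prod_list (map norm vs)"
      using that(1,2) unfolding has_multilinear_derivative_def by blast
    then show ?thesis by (rule eventually_mono) (simp add: that(3))
  qed
  consider "length vs \<noteq> Suc n" | v ws where "vs = v # ws" "length ws = n"
    by (cases vs) auto
  then show "L vs = L' vs"
  proof cases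
    case 1
    then show ?thesis
      using L L' unfolding has_multilinear_derivative_def bounded_multilinear_def by metis
  next
    case (2 v ws)
    show ?thesis
    proof (cases "v = 0")
      case True
      then show ?thesis using hom[OF L 2(2), of 0 0] hom[OF L' 2(2), of 0 0] 2 by simp
    next
      case False
      define p where "p = prod_list (map norm ws)"
      have p: "p \<ge> 0" unfolding p_def by (rule prod_list_norm_nonneg)
      have bound: "norm (L vs - L' vs) \<le> e * (2 * norm v * p)" if e: "e > 0" for e
      proof -
        have "\<forall>\<^sub>F y in at x. norm (G y ws - G x ws - L ((y - x) # ws)) \<le> e * norm (y - x) * p \<and>
            norm (G y ws - G x ws - L' ((y - x) # ws)) \<le> e * norm (y - x) * p"
          using ev[OF L e 2(2)] ev[OF L' e 2(2)] unfolding p_def by (rule eventually_conj)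
        then obtain d where d: "d > 0" "\<And>y. y \<noteq> x \<Longrightarrow> dist y x < d \<Longrightarrow>
            norm (G y ws - G x ws - L ((y - x) # ws)) \<le> e * norm (y - x) * p \<and>
            norm (G y ws - G x ws - L' ((y - x) # ws)) \<le> e * norm (y - x) * p"
          unfolding eventually_at by blast
        \<comment> \<open>The step \<open>t *\<^sub>R v\<close> then has length \<open>d / 2\<close>.\<close>
        define t where "t = d / (2 * norm v)"
        have t: "t > 0" "t * norm v < d" using d(1) False by (simp_all add: t_def)
        define h where "h = complex_of_real t *\<^sub>C v"
        have h: "norm h = t * norm v" using t by (simp add: h_def norm_scaleC)
        have "norm h > 0" unfolding h using t False by simp
        then have h0: "h \<noteq> 0" by auto
        have est: "norm (G (x + h) ws - G x ws - L (h # ws)) \<le> e * norm h * p \<and>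
            norm (G (x + h) ws - G x ws - L' (h # ws)) \<le> e * norm h * p"
          using d(2)[of "x + h"] h t h0 by (simp add: dist_norm)
        have "L (h # ws) - L' (h # ws) = (G (x + h) ws - G x ws - L' (h # ws)) - (G (x + h) ws - G x ws - L (h # ws))"
          by simp
        then have "norm (L (h # ws) - L' (h # ws)) \<le> 2 * (e * norm h * p)"
          using est norm_triangle_ineq4[of "G (x + h) ws - G x ws - L' (h # ws)" "G (x + h) ws - G x ws - L (h # ws)"]
          by simp
        moreover have "L (h # ws) - L' (h # ws) = complex_of_real t *\<^sub>C (L vs - L' vs)"
          by (simp add: h_def hom[OF L 2(2)] hom[OF L' 2(2)] 2(1) scaleC_diff_right)
        ultimately have "t * norm (L vs - L' vs) \<le> t * (e * (2 * norm v * p))"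
          using t by (simp add: norm_scaleC h mult_ac)
        then show ?thesis using t(1) by simp
      qed
      have "norm (L vs - L' vs) \<le> e" if e: "e > 0" for e
      proof -
        define K where "K = 2 * norm v * p"
        have K: "K \<ge> 0" using p by (simp add: K_def)
        have "norm (L vs - L' vs) \<le> e / (K + 1) * K"
          using bound[of "e / (K + 1)"] e K unfolding K_def[symmetric] by simp
        also have "\<dots> \<le> e" using e K by (simp add: field_simps)
        finally show ?thesis .
      qed
      then have "norm (L vs - L' vs) \<le> 0" using field_le_epsilon[of "norm (L vs - L' vs)" 0] by simp
      then show ?thesis by simp
    qed
  qed
qed

lemma has_multilinear_derivative_cong:
  assumes "has_multilinear_derivative n G L x" and "open S" "x \<in> S" "\<And>y. y \<in> S \<Longrightarrow> G y = H y"
  shows "has_multilinear_derivative n H L x"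
proof -
  have "\<forall>\<^sub>F y in at x. y \<in> S" using assms(2,3) by (rule eventually_at_in_open')
  then have "\<forall>\<^sub>F y in at x. \<forall>vs. length vs = n \<longrightarrow>
      norm (H y vs - H x vs - L ((y - x) # vs)) \<le> e * norm (y - x) * prod_list (map norm vs)"
    if "\<forall>\<^sub>F y in at x. \<forall>vs. length vs = n \<longrightarrow>
      norm (G y vs - G x vs - L ((y - x) # vs)) \<le> e * norm (y - x) * prod_list (map norm vs)" for e
    using that by eventually_elim (simp add: assms(3,4))
  then show ?thesis using assms(1) unfolding has_multilinear_derivative_def by blast
qed

lemma nth_frechet_eq_iter_deriv:
  fixes f :: "'a::complex_normed_vector \<Rightarrow> 'b::complex_banach"
  assumes f: "holomorphic_map S f"
  shows "x \<in> S \<Longrightarrow> nth_frechet n f x = iter_deriv n f x"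
proof (induction n arbitrary: x)
  case (Suc n)
  have "has_multilinear_derivative n (nth_frechet n f) (iter_deriv (Suc n) f x) x"
    by (rule has_multilinear_derivative_cong[OF iter_deriv_has_multilinear_derivative[OF f Suc.prems]
          holomorphic_map_open[OF f] Suc.prems Suc.IH[symmetric]])
  then show ?case
    unfolding nth_frechet.simps using has_multilinear_derivative_unique by (intro the_equality)
qed simp

lemma multilinear_replicate_scaleC:
  assumes L: "bounded_multilinear n L"
  shows "length us + j = n \<Longrightarrow> L (us @ replicate j (c *\<^sub>C v)) = c ^ j *\<^sub>C L (us @ replicate j v)"
proof (induction j arbitrary: us)
  case (Suc j)
  have "L (us @ (c *\<^sub>C v) # replicate j (c *\<^sub>C v)) = c *\<^sub>C L (us @ v # replicate j (c *\<^sub>C v))"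
    using L Suc.prems unfolding bounded_multilinear_def by simp
  also have "\<dots> = c *\<^sub>C L ((us @ [v]) @ replicate j (c *\<^sub>C v))" by simp
  also have "\<dots> = c *\<^sub>C (c ^ j *\<^sub>C L ((us @ [v]) @ replicate j v))"
    using Suc.prems by (subst Suc.IH) auto
  finally show ?case by (simp add: scaleC_scaleC)
qed simp

lemma taylor_term_scaleC:
  fixes f :: "'a::complex_normed_vector \<Rightarrow> 'b::complex_banach"
  assumes f: "holomorphic_map (ball 0 1) f"
  shows "taylor_term f n (c *\<^sub>C z) = c ^ n *\<^sub>C taylor_term f n z"
proof -
  have "bounded_multilinear n (nth_frechet n f 0)"
    using bounded_multilinear_iter_deriv[OF f] nth_frechet_eq_iter_deriv[OF f] by simp
  from multilinear_replicate_scaleC[OF this, of "[]" n c z]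
  show ?thesis
    by (simp add: taylor_term_def scaleC_scaleC mult.commute flip: scaleC_of_real)
qed

lemma higher_deriv_slice:
  fixes f :: "'a::complex_normed_vector \<Rightarrow> 'b::complex_banach"
  assumes f: "holomorphic_map (ball 0 1) f" and \<phi>: "functional \<phi>" and z: "norm z \<le> 1"
  shows "t \<in> ball 0 1 \<Longrightarrow>
    (deriv ^^ n) (\<lambda>t. \<phi> (f (t *\<^sub>C z))) t = \<phi> (iter_deriv n f (t *\<^sub>C z) (replicate n z))"
proof (induction n arbitrary: t)
  case (Suc n)
  have "((\<lambda>t. \<phi> (iter_deriv n f (0 + t *\<^sub>C z) (replicate n z))) has_field_derivative
      \<phi> (cderiv (\<lambda>x. iter_deriv n f x (replicate n z)) (0 + t *\<^sub>C z) z)) (at t)"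
    by (rule slice_has_field_derivative[OF holomorphic_iter_deriv[OF f] \<phi>])
      (use scaleC_in_unit_ball[OF z Suc.prems] in simp_all)
  then have "((\<lambda>t. \<phi> (iter_deriv n f (t *\<^sub>C z) (replicate n z))) has_field_derivative
      \<phi> (iter_deriv (Suc n) f (t *\<^sub>C z) (replicate (Suc n) z))) (at t)" by simp
  then have "((deriv ^^ n) (\<lambda>t. \<phi> (f (t *\<^sub>C z))) has_field_derivative
      \<phi> (iter_deriv (Suc n) f (t *\<^sub>C z) (replicate (Suc n) z))) (at t)"
    by (rule has_field_derivative_transform_within_open[OF _ open_ball Suc.prems])
      (simp add: Suc.IH)
  then show ?case by (simp add: DERIV_imp_deriv)
qed simp

text \<open>
  Along the disc spanned by \<open>z\<close> the homogeneous Taylor terms become the coefficients of an ordinary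
  power series, so the results about the unit disc apply to them.
\<close>

theorem slice_power_series:
  fixes f :: "'a::complex_normed_vector \<Rightarrow> 'b::complex_banach"
  assumes f: "holomorphic_map (ball 0 1) f" and \<phi>: "functional \<phi>" and z: "norm z \<le> 1"
    and t: "t \<in> ball 0 1"
  shows "(\<lambda>n. \<phi> (taylor_term f n z) * t ^ n) sums \<phi> (f (t *\<^sub>C z))"
proof -
  have "(\<lambda>t. \<phi> (f (0 + t *\<^sub>C z))) holomorphic_on ball 0 1"
    by (rule slice_holomorphic[OF f \<phi>]) (use z in auto)
  then have "(\<lambda>t. \<phi> (f (t *\<^sub>C z))) holomorphic_on ball 0 1" by simp
  from holomorphic_power_series[OF this t]
  have "(\<lambda>n. (deriv ^^ n) (\<lambda>t. \<phi> (f (t *\<^sub>C z))) 0 / fact n * t ^ n) sums \<phi> (f (t *\<^sub>C z))" by simp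
  moreover have "(deriv ^^ n) (\<lambda>t. \<phi> (f (t *\<^sub>C z))) 0 / fact n = \<phi> (taylor_term f n z)" for n
    using higher_deriv_slice[OF f \<phi> z, of 0 n] nth_frechet_eq_iter_deriv[OF f, of 0 n]
    by (simp add: taylor_term_def functional_scaleR[OF \<phi>] scaleR_conv_of_real divide_inverse mult.commute)
  ultimately show ?thesis by simp
qed

text \<open>
  A derivative of order \<open>j\<close> of a map that is homogeneous of degree \<open>k\<close> is homogeneous of degree
  \<open>k - j\<close>. For \<open>j < k\<close> the fixed point \<open>0\<close> of the scaling forces it to vanish there, for all
  arguments and not only on the diagonal. The factor
  \<open>1/2\<close> keeps the argument in the unit ball.
\<close>

lemma iter_deriv_zero_of_homogeneous:
  fixes f :: "'a::complex_normed_vector \<Rightarrow> 'b::complex_banach"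
  assumes f: "holomorphic_map (ball 0 1) f"
    and hom: "\<And>x. x \<in> ball 0 1 \<Longrightarrow> f ((1/2) *\<^sub>C x) = (1/2) ^ k *\<^sub>C f x" and j: "j < k"
  shows "iter_deriv j f 0 vs = 0"
proof (cases "length vs = j")
  case True
  have half: "0 + (1/2) *\<^sub>C x \<in> ball 0 1" if "x \<in> ball 0 1" for x :: 'a
    using that by (simp add: norm_scaleC)
  have scale: "x \<in> ball 0 1 \<Longrightarrow> length vs = j \<Longrightarrow> j \<le> k \<Longrightarrow>
      iter_deriv j f ((1/2) *\<^sub>C x) vs = (1/2) ^ (k - j) *\<^sub>C iter_deriv j f x vs" for x vs j
  proof (induction j arbitrary: x vs)
    case 0
    then show ?case using hom by simp
  next
    case (Suc j)
    then obtain u ws where vs: "vs = u # ws" "length ws = j" by (auto simp: length_Suc_conv)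
    define G where "G y = iter_deriv j f y ws" for y
    have G: "holomorphic_map (ball 0 1) G"
      unfolding G_def by (rule holomorphic_iter_deriv[OF f vs(2)])
    have "(1/2) *\<^sub>C cderiv G (0 + (1/2) *\<^sub>C x) u = cderiv (\<lambda>y. G (0 + (1/2) *\<^sub>C y)) x u"
      by (rule holomorphic_map_affine(2)[OF G open_ball half Suc.prems(1), symmetric])
    also have "\<dots> = cderiv (\<lambda>y. (1/2) ^ (k - j) *\<^sub>C G y) x u"
    proof (rule arg_cong[where f = "\<lambda>h. h u"], rule cderiv_cong)
      show "holomorphic_map (ball 0 1) (\<lambda>y. G (0 + (1/2) *\<^sub>C y))"
        by (rule holomorphic_map_affine(1)[OF G open_ball half])
      show "G (0 + (1/2) *\<^sub>C y) = (1/2) ^ (k - j) *\<^sub>C G y" if "y \<in> ball 0 1" for y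
        using Suc.IH[OF that vs(2)] Suc.prems(3) by (simp add: G_def)
    qed (rule Suc.prems(1))
    also have "\<dots> = (1/2) ^ (k - j) *\<^sub>C cderiv G x u"
      by (rule holomorphic_map_scaleC(2)[OF G Suc.prems(1)])
    finally have "2 *\<^sub>C (1/2) *\<^sub>C cderiv G ((1/2) *\<^sub>C x) u = 2 *\<^sub>C (1/2) ^ (k - j) *\<^sub>C cderiv G x u"
      by simp
    moreover have "k - j = Suc (k - Suc j)" using Suc.prems(3) by simp
    moreover have "(\<lambda>y. iter_deriv j f y ws) = G" by (simp add: G_def fun_eq_iff)
    ultimately show ?case by (simp add: scaleC_scaleC vs)
  qed
  have "iter_deriv j f 0 vs = (1/2) ^ (k - j) *\<^sub>C iter_deriv j f 0 vs"
    using scale[OF _ True, of 0] j by simp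
  then have "norm (iter_deriv j f 0 vs) = (1/2) ^ (k - j) * norm (iter_deriv j f 0 vs)"
    by (metis norm_scaleC norm_power norm_divide norm_one norm_numeral)
  moreover have "(1/2::real) ^ (k - j) < 1" using j by (simp add: power_less_one_iff) 
  ultimately show ?thesis by auto
qed (rule iter_deriv_wrong_length)

section \<open>Maps into the polydisc and Schwarz maps\<close>

lemma maxnorm_le_iff: "maxnorm w \<le> B \<longleftrightarrow> (\<forall>i. cmod (w $ i) \<le> B)"
  unfolding maxnorm_def by (subst Max_le_iff) auto

lemma maxnorm_less_iff: "maxnorm w < B \<longleftrightarrow> (\<forall>i. cmod (w $ i) < B)"
  unfolding maxnorm_def by (subst Max_less_iff) auto

lemma cmod_nth_le_maxnorm: "cmod (w $ i) \<le> maxnorm w"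
  using maxnorm_le_iff by blast

lemma maxnorm_nonneg: "0 \<le> maxnorm w"
  using cmod_nth_le_maxnorm[of w undefined] norm_ge_zero order_trans by blast

lemma closure_polydisc_le: "w \<in> closure polydisc \<Longrightarrow> maxnorm w \<le> 1"
proof -
  have "closed {w :: complex ^ 'm. \<forall>i. cmod (w $ i) \<le> 1}"
    by (intro closed_Collect_all closed_Collect_le continuous_intros)
  then have "closure (polydisc :: (complex ^ 'm) set) \<subseteq> {w. \<forall>i. cmod (w $ i) \<le> 1}"
    by (rule closure_minimal[rotated]) (auto simp: polydisc_def maxnorm_less_iff less_imp_le)
  then show "w \<in> closure polydisc \<Longrightarrow> maxnorm w \<le> 1" for w :: "complex ^ 'm"
    unfolding maxnorm_le_iff by blast
qed

lemma functional_nth: "functional (\<lambda>w :: complex ^ 'm. w $ i)"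
  unfolding functional_def
  by (auto simp: scaleC_vec_def scaleC_complex_def Finite_Cartesian_Product.norm_nth_le)

text \<open>
  The vector \<open>e\<close> is only required to have norm at most one, which covers \<open>z = 0\<close>.
\<close>

lemma ex_direction:
  fixes z :: "'a::complex_normed_vector"
  obtains e where "norm e \<le> 1" "z = complex_of_real (norm z) *\<^sub>C e"
proof
  show "norm ((1 / norm z) *\<^sub>R z) \<le> 1" by (simp add: divide_simps)
  show "z = complex_of_real (norm z) *\<^sub>C ((1 / norm z) *\<^sub>R z)" by (simp add: scaleC_of_real)
qed

lemma taylor_term_0: "taylor_term f 0 z = f 0"
  by (simp add: taylor_term_def)

text \<open>
  The coefficient bound depends on the coordinate only through the modulus of its value at \<open>0\<close>,
  and this is where the assumption that all of these moduli agree enters.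
\<close>

lemma taylor_term_bound:
  fixes F :: "'a::complex_normed_vector \<Rightarrow> complex ^ 'm"
  assumes F: "polydisc_map a F" and n: "n \<ge> 1"
  shows "maxnorm (taylor_term F n z) \<le> (1 - (maxnorm a)\<^sup>2) * norm z ^ n"
proof -
  obtain e where e: "norm e \<le> 1" "z = complex_of_real (norm z) *\<^sub>C e" by (rule ex_direction)
  have holo: "holomorphic_map (ball 0 1) F" using F by (simp add: polydisc_map_def)
  show ?thesis
    unfolding maxnorm_le_iff
  proof
    fix i
    have "cmod (taylor_term F n e $ i) \<le> 1 - (cmod (taylor_term F 0 e $ i))\<^sup>2"
    proof (rule bounded_coefficient[OF slice_power_series[OF holo functional_nth e(1)] _ n])
      fix s :: complex assume s: "s \<in> ball 0 1"
      have "s *\<^sub>C e \<in> ball 0 1" using e(1) s by (rule scaleC_in_unit_ball)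
      then have "F (s *\<^sub>C e) \<in> closure polydisc" using F unfolding polydisc_map_def by blast
      then show "cmod (F (s *\<^sub>C e) $ i) \<le> 1"
        using closure_polydisc_le maxnorm_le_iff by blast
    qed
    moreover have "cmod (taylor_term F 0 e $ i) = maxnorm a"
      using F unfolding taylor_term_0 polydisc_map_def by simp
    moreover have "taylor_term F n z = complex_of_real (norm z) ^ n *\<^sub>C taylor_term F n e"
      by (subst e(2)) (rule taylor_term_scaleC[OF holo])
    then have "cmod (taylor_term F n z $ i) = norm z ^ n * cmod (taylor_term F n e $ i)"
      by (simp add: functional_scaleC[OF functional_nth] norm_mult norm_power)
    ultimately show "cmod (taylor_term F n z $ i) \<le> (1 - (maxnorm a)\<^sup>2) * norm z ^ n"
      by (metis mult.commute mult_left_mono norm_ge_zero zero_le_power)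
  qed
qed

lemma polydisc_map_growth:
  fixes F :: "'a::complex_normed_vector \<Rightarrow> complex ^ 'm"
  assumes F: "polydisc_map a F" and w: "norm w < 1"
  shows "maxnorm (F w) \<le> (maxnorm a + norm w) / (1 + maxnorm a * norm w)"
  unfolding maxnorm_le_iff
proof
  fix i
  obtain e where e: "norm e \<le> 1" "w = complex_of_real (norm w) *\<^sub>C e" by (rule ex_direction)
  have holo: "holomorphic_map (ball 0 1) F" and F0: "F 0 = a" and ai: "cmod (a $ i) = maxnorm a"
    using F by (simp_all add: polydisc_map_def)
  define f where "f t = F (0 + t *\<^sub>C e) $ i" for t
  have "cmod (f (complex_of_real (norm w))) \<le>
    (cmod (f 0) + cmod (complex_of_real (norm w))) / (1 + cmod (f 0) * cmod (complex_of_real (norm w)))"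
  proof (rule schwarz_pick_growth)
    show "f holomorphic_on ball 0 1"
      unfolding f_def by (rule slice_holomorphic[OF holo functional_nth]) (use e in auto)
    fix s :: complex assume s: "s \<in> ball 0 1"
    have "0 + s *\<^sub>C e \<in> ball 0 1" using scaleC_in_unit_ball[OF e(1) s] by simp
    then have "F (0 + s *\<^sub>C e) \<in> closure polydisc" using F unfolding polydisc_map_def by blast
    then show "cmod (f s) \<le> 1"
      unfolding f_def using closure_polydisc_le maxnorm_le_iff by blast
  qed (use w in simp)
  moreover have "f (complex_of_real (norm w)) = F w $ i" using e(2) by (simp add: f_def)
  ultimately show "cmod (F w $ i) \<le> (maxnorm a + norm w) / (1 + maxnorm a * norm w)"
    by (simp add: f_def F0 ai)
qed

lemma schwarz_map_growth:
  fixes \<nu> :: "'a::complex_banach \<Rightarrow> 'a"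
  assumes \<nu>: "schwarz_map \<nu>" and van: "vanishes_to_order k \<nu>" and z: "norm z < 1"
  shows "norm (\<nu> z) \<le> norm z ^ k"
proof (rule norm_le_by_functionals)
  fix \<phi> :: "'a \<Rightarrow> complex" assume \<phi>: "functional \<phi>"
  obtain e where e: "norm e \<le> 1" "z = complex_of_real (norm z) *\<^sub>C e" by (rule ex_direction)
  have holo: "holomorphic_map (ball 0 1) \<nu>" using \<nu> by (simp add: schwarz_map_def)
  have "cmod (\<phi> (\<nu> (complex_of_real (norm z) *\<^sub>C e))) \<le> cmod (complex_of_real (norm z)) ^ k"
  proof (rule schwarz_order[OF slice_power_series[OF holo \<phi> e(1)]])
    fix s :: complex assume s: "s \<in> ball 0 1"
    have "s *\<^sub>C e \<in> ball 0 1" using e(1) s by (rule scaleC_in_unit_ball)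
    then have "\<nu> (s *\<^sub>C e) \<in> ball 0 1" using \<nu> unfolding schwarz_map_def by blast
    then show "cmod (\<phi> (\<nu> (s *\<^sub>C e))) \<le> 1"
      using functional_le_norm[OF \<phi>, of "\<nu> (s *\<^sub>C e)"] by simp
  next
    fix j assume "j < k"
    then show "\<phi> (taylor_term \<nu> j e) = 0"
      using van functional_scaleC[OF \<phi>, of 0 0] by (simp add: vanishes_to_order_def taylor_term_def)
  next
    show "complex_of_real (norm z) \<in> ball 0 1" using z by simp
  qed
  then show "cmod (\<phi> (\<nu> z)) \<le> norm z ^ k" using e(2) by simp
qed

section \<open>The Bohr radius and the inequality between real numbers\<close>

definition bohr_gap :: "nat \<Rightarrow> real \<Rightarrow> real" where
  "bohr_gap k r = (1 - r ^ k) / (1 + r ^ k) - 2 * r / (1 - r)"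

lemma bohr_gap_strict_antimono:
  assumes "0 \<le> r" "r < s" "s < 1"
  shows "bohr_gap k s < bohr_gap k r"
proof -
  have rs: "r ^ k \<le> s ^ k" and pos: "0 \<le> r ^ k" and "r ^ k \<le> 1"
    using assms by (auto intro: power_mono power_le_one)
  have "(1 - s ^ k) / (1 + s ^ k) \<le> (1 - r ^ k) / (1 + r ^ k)"
    using rs pos \<open>r ^ k \<le> 1\<close> by (intro frac_le) auto
  moreover have "2 * r / (1 - r) < 2 * s / (1 - s)"
    using assms by (simp add: frac_less divide_simps algebra_simps)
  ultimately show ?thesis by (simp add: bohr_gap_def)
qed

text \<open>
  At \<open>1/3\<close> the subtracted term equals \<open>1\<close> and the other one is smaller.
\<close>

lemma ex_bohr_gap_root:
  assumes "k \<ge> 1"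
  obtains r where "0 < r" "r \<le> 1/3" "bohr_gap k r = 0"
proof -
  have "bohr_gap k (1/3) \<le> 0"
    by (simp add: bohr_gap_def divide_simps) (simp add: add_pos_pos)
  moreover have g0: "bohr_gap k 0 = 1" using assms by (simp add: bohr_gap_def power_0_left)
  moreover have "continuous_on {0..1/3} (bohr_gap k)"
    unfolding bohr_gap_def
  proof (intro continuous_intros ballI)
    fix x :: real assume "x \<in> {0..1/3}"
    then have "0 \<le> x ^ k" by simp
    then show "1 + x ^ k \<noteq> 0" by linarith
  qed auto
  ultimately obtain r where "0 \<le> r" "r \<le> 1/3" "bohr_gap k r = 0"
    using IVT2'[of "bohr_gap k" "1/3" 0 0] by auto
  moreover have "r \<noteq> 0" using g0 \<open>bohr_gap k r = 0\<close> by auto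
  ultimately show ?thesis using that[of r] by simp
qed

lemma bohr_radius_facts:
  assumes k: "k \<ge> 1"
  shows ex1_bohr_root: "\<exists>!r. is_bohr_root k r"
    and bohr_radius_pos: "0 < bohr_radius k" and bohr_radius_le: "bohr_radius k \<le> 1/3"
    and bohr_gap_nonneg: "0 \<le> r \<Longrightarrow> r \<le> bohr_radius k \<Longrightarrow> 0 \<le> bohr_gap k r"
    and bohr_gap_neg: "bohr_radius k < r \<Longrightarrow> r < 1 \<Longrightarrow> bohr_gap k r < 0"
proof -
  obtain \<rho> where \<rho>: "0 < \<rho>" "\<rho> \<le> 1/3" "bohr_gap k \<rho> = 0" by (rule ex_bohr_gap_root[OF k])
  have root: "is_bohr_root k r \<longleftrightarrow> 0 < r \<and> r < 1 \<and> bohr_gap k r = 0" for r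
    by (simp add: is_bohr_root_def bohr_gap_def)
  have uniq: "r = \<rho>" if "is_bohr_root k r" for r
    using that \<rho> bohr_gap_strict_antimono[of r \<rho> k] bohr_gap_strict_antimono[of \<rho> r k]
    unfolding root by (cases r \<rho> rule: linorder_cases) auto
  have \<rho>_root: "is_bohr_root k \<rho>" using \<rho> by (simp add: root)
  then show "\<exists>!r. is_bohr_root k r" using uniq by blast
  have eq: "bohr_radius k = \<rho>" unfolding bohr_radius_def using \<rho>_root uniq by (rule the_equality)
  show "0 < bohr_radius k" "bohr_radius k \<le> 1/3" using \<rho> by (simp_all add: eq)
  show "0 \<le> bohr_gap k r" if "0 \<le> r" "r \<le> bohr_radius k"
    using that \<rho> bohr_gap_strict_antimono[of r \<rho> k] by (cases "r = \<rho>") (auto simp: eq)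
  show "bohr_gap k r < 0" if "bohr_radius k < r" "r < 1"
    using that \<rho> bohr_gap_strict_antimono[of \<rho> r k] by (auto simp: eq)
qed

text \<open>
  Here \<open>1 / (1 + \<alpha>) + r / (1 - r) = (1 + \<alpha> r) / ((1 + \<alpha>) (1 - r))\<close>, so the second summand is
  \<open>(1 - \<alpha>)\<^sup>2 r / (1 - r)\<close> times \<open>(1 + \<alpha> r) (1 + \<alpha>) r / (1 - r\<^sup>2)\<close>. The last factor is largest for
  \<open>\<alpha> = 1\<close>, where it is \<open>2 r / (1 - r)\<close>, and this is at most \<open>1\<close> exactly for \<open>r \<le> 1/3\<close>. Finally
  \<open>(1 - \<alpha>\<^sup>2) + (1 - \<alpha>)\<^sup>2 = 2 (1 - \<alpha>)\<close>.
\<close>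

lemma bohr_majorant_le:
  fixes \<alpha> r :: real
  assumes \<alpha>: "0 \<le> \<alpha>" "\<alpha> \<le> 1" and r: "0 \<le> r" "r \<le> 1/3"
  shows "(1 - \<alpha>\<^sup>2) * (r / (1 - r)) + (1 / (1 + \<alpha>) + r / (1 - r)) * ((1 - \<alpha>\<^sup>2)\<^sup>2 * (r\<^sup>2 / (1 - r\<^sup>2)))
    \<le> (1 - \<alpha>) * (2 * r / (1 - r))"
proof -
  define q where "q = r / (1 - r)"
  have q: "q \<ge> 0" using r by (simp add: q_def)
  have r2: "1 - r\<^sup>2 > 0" using r by (simp add: power_less_one_iff)
  have "(1 + \<alpha> * r) * (1 + \<alpha>) * r \<le> (1 + r) * 2 * r"
    using \<alpha> r by (intro mult_right_mono mult_mono add_left_mono) (auto simp: mult_left_le_one_le)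
  also have "\<dots> \<le> (1 + r) * (1 - r)" using r by (simp only: mult.assoc) (intro mult_left_mono, auto)
  finally have key: "(1 + \<alpha> * r) * (1 + \<alpha>) * r / (1 - r\<^sup>2) \<le> 1"
    using r2 by (simp add: power2_eq_square algebra_simps)
  have "(1 / (1 + \<alpha>) + r / (1 - r)) = (1 + \<alpha> * r) / ((1 + \<alpha>) * (1 - r))"
    using \<alpha> r by (simp add: divide_simps) (simp add: algebra_simps)
  then have "(1 / (1 + \<alpha>) + r / (1 - r)) * ((1 - \<alpha>\<^sup>2)\<^sup>2 * (r\<^sup>2 / (1 - r\<^sup>2))) =
      (1 - \<alpha>)\<^sup>2 * q * ((1 + \<alpha> * r) * (1 + \<alpha>) * r / (1 - r\<^sup>2))"
    using \<alpha> r r2 by (simp add: q_def divide_simps) (simp add: power2_eq_square algebra_simps)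
  also have "\<dots> \<le> (1 - \<alpha>)\<^sup>2 * q" using key q by (intro mult_left_le) auto
  finally have "(1 - \<alpha>\<^sup>2) * q + (1 / (1 + \<alpha>) + r / (1 - r)) * ((1 - \<alpha>\<^sup>2)\<^sup>2 * (r\<^sup>2 / (1 - r\<^sup>2)))
      \<le> (1 - \<alpha>\<^sup>2) * q + (1 - \<alpha>)\<^sup>2 * q" by simp
  also have "\<dots> = (1 - \<alpha>) * (2 * q)" by (simp add: power2_eq_square algebra_simps)
  finally show ?thesis by (simp add: q_def)
qed

lemma one_minus_moebius:
  fixes \<alpha> x :: real
  assumes "0 \<le> \<alpha>" "0 \<le> x"
  shows "1 - (\<alpha> + x) / (1 + \<alpha> * x) = (1 - \<alpha>) * ((1 - x) / (1 + \<alpha> * x))"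
proof -
  have "1 + \<alpha> * x > 0" using assms by (simp add: add_pos_nonneg)
  then show ?thesis by (simp add: field_simps)
qed

section \<open>The Bohr inequality\<close>

context
  fixes a :: "complex ^ 'm" and F :: "'a::complex_banach \<Rightarrow> complex ^ 'm" and z :: 'a
  assumes F: "polydisc_map a F" and z: "norm z < 1"
begin

lemma maxnorm_center_le: "maxnorm a \<le> 1"
  using F closure_polydisc_le by (auto simp: polydisc_map_def)

lemma taylor_majorant_sums:
  "(\<lambda>n. (1 - (maxnorm a)\<^sup>2) * norm z ^ Suc n) sums ((1 - (maxnorm a)\<^sup>2) * (norm z / (1 - norm z)))"
  using sums_mult[OF sums_mult[OF geometric_sums[of "norm z"]], of "1 - (maxnorm a)\<^sup>2" "norm z"] z
  by simp

lemma taylor_square_majorant_sums: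
  "(\<lambda>n. ((1 - (maxnorm a)\<^sup>2) * norm z ^ Suc n)\<^sup>2) sums
    ((1 - (maxnorm a)\<^sup>2)\<^sup>2 * ((norm z)\<^sup>2 / (1 - (norm z)\<^sup>2)))"
proof -
  have "norm ((norm z)\<^sup>2) < 1" using z by (simp add: power_less_one_iff)
  from sums_mult[OF sums_mult[OF geometric_sums[OF this]], of "(1 - (maxnorm a)\<^sup>2)\<^sup>2" "(norm z)\<^sup>2"]
  show ?thesis by (simp add: power_mult_distrib power_mult[symmetric] mult.commute[of _ 2])
qed

lemma taylor_square_le:
  "(maxnorm (taylor_term F (Suc n) z))\<^sup>2 \<le> ((1 - (maxnorm a)\<^sup>2) * norm z ^ Suc n)\<^sup>2"
  using taylor_term_bound[OF F, of "Suc n" z] maxnorm_nonneg by (intro power_mono) auto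

lemma summable_taylor: "summable (\<lambda>n. maxnorm (taylor_term F (Suc n) z))"
  using taylor_term_bound[OF F, of "Suc _" z]
  by (intro summable_comparison_test'[OF sums_summable[OF taylor_majorant_sums], of 0])
    (auto simp: maxnorm_nonneg)

lemma summable_taylor_square: "summable (\<lambda>n. (maxnorm (taylor_term F (Suc n) z))\<^sup>2)"
  by (intro summable_comparison_test'[OF sums_summable[OF taylor_square_majorant_sums], of 0])
    (use taylor_square_le in auto)

lemma bohr_lhs_le:
  assumes \<nu>: "schwarz_map \<nu>" "vanishes_to_order k \<nu>" and k: "k \<ge> 1" and le: "norm z \<le> bohr_radius k"
  shows "bohr_lhs a F \<nu> z \<le> 1"
proof -
  define \<alpha> r x where "\<alpha> = maxnorm a" and "r = norm z" and "x = norm z ^ k"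
  have \<alpha>: "0 \<le> \<alpha>" "\<alpha> \<le> 1" using maxnorm_nonneg maxnorm_center_le by (auto simp: \<alpha>_def)
  have r: "0 \<le> r" "r \<le> 1/3" using le bohr_radius_le[OF k] by (auto simp: r_def)
  have x: "0 \<le> x" "x \<le> 1" using z by (auto simp: x_def power_le_one)
  have \<nu>z: "norm (\<nu> z) \<le> x" unfolding x_def by (rule schwarz_map_growth[OF \<nu> z])
  have "\<nu> z \<in> ball 0 1" using \<nu>(1) z unfolding schwarz_map_def by fastforce
  then have "norm (\<nu> z) < 1" by simp
  from polydisc_map_growth[OF F this]
  have "maxnorm (F (\<nu> z)) \<le> (\<alpha> + norm (\<nu> z)) / (1 + \<alpha> * norm (\<nu> z))" by (simp add: \<alpha>_def)
  also have "\<dots> = 1 - (1 - \<alpha>) * ((1 - norm (\<nu> z)) / (1 + \<alpha> * norm (\<nu> z)))"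
    using one_minus_moebius[OF \<alpha>(1), of "norm (\<nu> z)"] by simp
  also have "\<dots> \<le> 1 - (1 - \<alpha>) * (2 * r / (1 - r))"
  proof -
    have "2 * r / (1 - r) \<le> (1 - x) / (1 + x)"
      using bohr_gap_nonneg[OF k r(1)] le by (simp add: bohr_gap_def r_def x_def)
    \<comment> \<open>Both \<open>norm (\<nu> z) \<le> x\<close> and \<open>\<alpha> \<le> 1\<close> enlarge the quotient.\<close>
    also have "\<dots> \<le> (1 - norm (\<nu> z)) / (1 + \<alpha> * norm (\<nu> z))"
    proof (rule frac_le)
      have "\<alpha> * norm (\<nu> z) \<le> 1 * x" using \<nu>z \<alpha> by (intro mult_mono) auto
      then show "1 + \<alpha> * norm (\<nu> z) \<le> 1 + x" by simp
      show "0 < 1 + \<alpha> * norm (\<nu> z)" using \<alpha> by (simp add: add_pos_nonneg)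
    qed (use \<nu>z x in auto)
    finally have "(1 - \<alpha>) * (2 * r / (1 - r)) \<le> (1 - \<alpha>) * ((1 - norm (\<nu> z)) / (1 + \<alpha> * norm (\<nu> z)))"
      by (rule mult_left_mono) (use \<alpha> in simp)
    then show ?thesis by linarith
  qed
  finally have growth: "maxnorm (F (\<nu> z)) \<le> 1 - (1 - \<alpha>) * (2 * r / (1 - r))" .
  have s1: "(\<Sum>n. maxnorm (taylor_term F (Suc n) z)) \<le> (1 - \<alpha>\<^sup>2) * (r / (1 - r))"
    unfolding \<alpha>_def r_def sums_unique[OF taylor_majorant_sums]
    by (intro suminf_le summable_taylor sums_summable[OF taylor_majorant_sums] taylor_term_bound[OF F]) simp
  have s2: "(\<Sum>n. (maxnorm (taylor_term F (Suc n) z))\<^sup>2) \<le> (1 - \<alpha>\<^sup>2)\<^sup>2 * (r\<^sup>2 / (1 - r\<^sup>2))"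
    unfolding \<alpha>_def r_def sums_unique[OF taylor_square_majorant_sums]
    by (intro suminf_le summable_taylor_square sums_summable[OF taylor_square_majorant_sums] taylor_square_le)
  have "0 \<le> 1 / (1 + \<alpha>) + r / (1 - r)" using \<alpha> r by simp
  from mult_left_mono[OF s2 this] s1 growth bohr_majorant_le[OF \<alpha> r]
  show ?thesis unfolding bohr_lhs_def \<alpha>_def r_def by linarith
qed

end

section \<open>Sharpness of the radius\<close>

lemma holomorphic_map_mult_functional:
  fixes f :: "'a::complex_normed_vector \<Rightarrow> 'b::complex_normed_vector"
  assumes \<phi>: "functional \<phi>" and m: "m holomorphic_on T" and T: "open T" "\<phi> ` S \<subseteq> T"
    and f: "holomorphic_map S f"
  shows "holomorphic_map S (\<lambda>x. m (\<phi> x) *\<^sub>C f x)"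
proof (rule holomorphic_mapI[OF holomorphic_map_open[OF f]])
  fix x assume x: "x \<in> S"
  have "(m has_field_derivative deriv m (\<phi> x)) (at (\<phi> x))"
    using holomorphic_derivI[OF m T(1)] T(2) x by blast
  then have "(m has_derivative (*) (deriv m (\<phi> x))) (at (\<phi> x))"
    by (simp add: has_field_derivative_def)
  from diff_chain_at[OF bounded_linear_imp_has_derivative[OF functional_bounded_linear[OF \<phi>]] this]
  have "((\<lambda>x. m (\<phi> x)) has_derivative (\<lambda>v. deriv m (\<phi> x) * \<phi> v)) (at x)" by (simp add: o_def)
  from bounded_bilinear.FDERIV[OF bounded_bilinear_scaleC this holomorphic_map_has_derivative[OF f x]]
  show "((\<lambda>x. m (\<phi> x) *\<^sub>C f x) has_derivative
      (\<lambda>v. m (\<phi> x) *\<^sub>C cderiv f x v + (deriv m (\<phi> x) * \<phi> v) *\<^sub>C f x)) (at x)" .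
  show "m (\<phi> x) *\<^sub>C cderiv f x (c *\<^sub>C v) + (deriv m (\<phi> x) * \<phi> (c *\<^sub>C v)) *\<^sub>C f x =
      c *\<^sub>C (m (\<phi> x) *\<^sub>C cderiv f x v + (deriv m (\<phi> x) * \<phi> v) *\<^sub>C f x)" for c v
    by (simp add: cderiv_scaleC[OF f x] functional_scaleC[OF \<phi>] scaleC_add_right scaleC_scaleC mult_ac)
qed

lemma taylor_terms_sums:
  fixes F :: "'a::complex_normed_vector \<Rightarrow> complex ^ 'm"
  assumes F: "holomorphic_map (ball 0 1) F" and z: "norm z < 1"
  shows "(\<lambda>n. taylor_term F (Suc n) z) sums (F z - F 0)"
proof -
  obtain e where e: "norm e \<le> 1" "z = complex_of_real (norm z) *\<^sub>C e" by (rule ex_direction)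
  have eq: "taylor_term F n z = complex_of_real (norm z) ^ n *\<^sub>C taylor_term F n e" for n
    by (subst e(2)) (rule taylor_term_scaleC[OF F])
  have "(\<lambda>n. taylor_term F n z $ i) sums (F z $ i)" for i
  proof -
    have "(\<lambda>n. taylor_term F n e $ i * complex_of_real (norm z) ^ n) sums
        (F (complex_of_real (norm z) *\<^sub>C e) $ i)"
      by (rule slice_power_series[OF F functional_nth e(1)]) (use z in simp)
    then show ?thesis
      by (simp add: eq functional_scaleC[OF functional_nth] mult.commute flip: e(2))
  qed
  then have "(\<lambda>n. taylor_term F n z) sums F z"
    unfolding sums_def by (intro vec_tendstoI) simp
  then show ?thesis by (subst sums_Suc_iff) (simp add: taylor_term_0)
qed

text \<open>
  For the extremal map below this bound is an equality, because at the point under consideration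
  all its Taylor terms of positive degree are negative multiples of one vector.
\<close>

lemma maxnorm_le_suminf_taylor:
  fixes F :: "'a::complex_banach \<Rightarrow> complex ^ 'm"
  assumes F: "polydisc_map a F" and z: "norm z < 1"
  shows "maxnorm (F z - a) \<le> (\<Sum>n. maxnorm (taylor_term F (Suc n) z))"
  unfolding maxnorm_le_iff
proof
  fix i
  have "(\<lambda>n. taylor_term F (Suc n) z) sums (F z - a)"
    using F z by (simp add: polydisc_map_def)
  from bounded_linear.sums[OF functional_bounded_linear[OF functional_nth] this]
  have "(\<lambda>n. taylor_term F (Suc n) z $ i) sums ((F z - a) $ i)" .
  then have "(F z - a) $ i = (\<Sum>n. taylor_term F (Suc n) z $ i)" by (rule sums_unique)
  also have "cmod \<dots> \<le> (\<Sum>n. maxnorm (taylor_term F (Suc n) z))"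
    by (intro norm_suminf_le cmod_nth_le_maxnorm summable_taylor[OF F z])
  finally show "cmod ((F z - a) $ i) \<le> (\<Sum>n. maxnorm (taylor_term F (Suc n) z))" .
qed

text \<open>
  The automorphism of the unit disc that exchanges \<open>0\<close> and \<open>\<alpha>\<close>.
\<close>

definition blaschke :: "real \<Rightarrow> complex \<Rightarrow> complex" where
  "blaschke \<alpha> t = (of_real \<alpha> - t) / (1 - of_real \<alpha> * t)"

lemma blaschke_denominator: "0 \<le> \<alpha> \<Longrightarrow> \<alpha> < 1 \<Longrightarrow> cmod t < 1 \<Longrightarrow> 1 - of_real \<alpha> * t \<noteq> 0"
proof
  assume *: "0 \<le> \<alpha>" "\<alpha> < 1" "cmod t < 1" and "1 - of_real \<alpha> * t = 0"
  then have "cmod (of_real \<alpha> * t) = 1" by (metis eq_iff_diff_eq_0 norm_one)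
  then have "\<alpha> * cmod t = 1" using * by (simp add: norm_mult)
  moreover have "\<alpha> * cmod t \<le> \<alpha>" using * by (intro mult_left_le) auto
  ultimately show False using * by simp
qed

lemma blaschke_holomorphic:
  "0 \<le> \<alpha> \<Longrightarrow> \<alpha> < 1 \<Longrightarrow> blaschke \<alpha> holomorphic_on ball 0 1"
  unfolding blaschke_def using blaschke_denominator by (intro holomorphic_intros) auto

lemma cmod_blaschke_less:
  assumes "0 \<le> \<alpha>" "\<alpha> < 1" "cmod t < 1"
  shows "cmod (blaschke \<alpha> t) < 1"
proof -
  have "0 < (1 - (cmod (of_real \<alpha>))\<^sup>2) * (1 - (cmod t)\<^sup>2)"
    using assms by (intro mult_pos_pos) (auto simp: power_less_one_iff)
  then have "(cmod (t - of_real \<alpha>))\<^sup>2 < (cmod (1 - of_real \<alpha> * t))\<^sup>2"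
    using moebius_identity[of "of_real \<alpha>" t] by simp
  then have "cmod (of_real \<alpha> - t) < cmod (1 - of_real \<alpha> * t)"
    by (subst norm_minus_commute) (rule power_less_imp_less_base, auto)
  then show ?thesis
    using blaschke_denominator[OF assms] by (simp add: blaschke_def norm_divide)
qed

lemma maxnorm_scaleC_ones: "maxnorm (c *\<^sub>C (\<chi> i. 1 :: complex ^ 'm)) = cmod c"
  by (simp add: maxnorm_def scaleC_vec_def scaleC_complex_def)

lemma blaschke_polydisc_map:
  fixes \<phi> :: "'a::complex_normed_vector \<Rightarrow> complex"
  assumes \<phi>: "functional \<phi>" and \<alpha>: "0 \<le> \<alpha>" "\<alpha> < 1"
  shows "polydisc_map (of_real \<alpha> *\<^sub>C (\<chi> i. 1)) (\<lambda>z. blaschke \<alpha> (\<phi> z) *\<^sub>C (\<chi> i. 1) :: complex ^ 'm)"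
    (is "polydisc_map ?a ?F")
proof -
  have small: "cmod (\<phi> z) < 1" if "z \<in> ball 0 1" for z
    using functional_le_norm[OF \<phi>, of z] that by simp
  have "holomorphic_map (ball 0 1) (\<lambda>_ :: 'a. (\<chi> i. 1) :: complex ^ 'm)"
    by (rule holomorphic_mapI[where L = "\<lambda>_ _. 0"]) auto
  then have holo: "holomorphic_map (ball 0 1) ?F"
    by (intro holomorphic_map_mult_functional[OF \<phi> blaschke_holomorphic[OF \<alpha>]]) (use small in auto)
  have "\<phi> 0 = 0" using functional_scaleC[OF \<phi>, of 0 0] by simp
  then have F0: "?F 0 = ?a" by (simp add: blaschke_def)
  have in_polydisc: "?F z \<in> polydisc" if "z \<in> ball 0 1" for z
    using cmod_blaschke_less[OF \<alpha> small[OF that]] by (simp add: polydisc_def maxnorm_scaleC_ones)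
  have "?a \<in> polydisc" using \<alpha> by (simp add: polydisc_def maxnorm_scaleC_ones)
  moreover have "cmod (?a $ i) = maxnorm ?a" for i
    unfolding maxnorm_scaleC_ones by (simp add: scaleC_vec_def scaleC_complex_def)
  moreover have "(\<lambda>n. taylor_term ?F (Suc n) z) sums (?F z - ?a)" if "z \<in> ball 0 1" for z
    using taylor_terms_sums[OF holo, of z] that unfolding F0 by simp
  ultimately show ?thesis
    unfolding polydisc_map_def
    using holo F0 in_polydisc closure_subset[of "polydisc :: (complex ^ 'm) set"]
    by (intro conjI ballI allI) (blast | assumption)+
qed

lemma power_schwarz_map:
  fixes \<phi> :: "'a::complex_banach \<Rightarrow> complex"
  assumes \<phi>: "functional \<phi>" and k: "k \<ge> 1"
  defines "\<nu> \<equiv> \<lambda>z. (- (\<phi> z ^ (k - 1))) *\<^sub>C z"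
  shows "schwarz_map \<nu>" "vanishes_to_order k \<nu>"
proof -
  have "holomorphic_map (ball 0 1) (\<lambda>z :: 'a. z)"
    by (rule holomorphic_mapI[where L = "\<lambda>_ v. v"]) (auto intro: derivative_intros)
  then have holo: "holomorphic_map (ball 0 1) \<nu>"
    unfolding \<nu>_def
    by (intro holomorphic_map_mult_functional[OF \<phi>, where T = UNIV and m = "\<lambda>t. - (t ^ (k - 1))"] holomorphic_intros) auto
  have "norm (\<nu> z) < 1" if "norm z < 1" for z
  proof -
    have "cmod (\<phi> z) ^ (k - 1) \<le> 1"
      using functional_le_norm[OF \<phi>, of z] that by (intro power_le_one) auto
    then have "norm (\<nu> z) \<le> 1 * norm z"
      unfolding \<nu>_def norm_scaleC by (intro mult_right_mono) (auto simp: norm_power)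
    then show ?thesis using that by simp
  qed
  then show "schwarz_map \<nu>" using holo by (auto simp: schwarz_map_def \<nu>_def)
  have "\<nu> ((1/2) *\<^sub>C x) = (1/2) ^ k *\<^sub>C \<nu> x" for x
    using k by (cases k)
      (simp_all add: \<nu>_def functional_scaleC[OF \<phi>] scaleC_scaleC power_mult_distrib power_divide mult_ac)
  then show "vanishes_to_order k \<nu>"
    unfolding vanishes_to_order_def
    using iter_deriv_zero_of_homogeneous[OF holo] nth_frechet_eq_iter_deriv[OF holo] by auto
qed

text \<open>
  After subtracting \<open>1\<close> and dividing by \<open>1 - \<alpha>\<close>, the claim reads
  \<open>(1 + \<alpha>) R / (1 - \<alpha> R) > (1 - R\<^sup>k) / (1 + \<alpha> R\<^sup>k)\<close>. In the limit \<open>\<alpha> = 1\<close> this is the inequality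
  \<open>bohr_gap k R < 0\<close>, so it persists for \<open>\<alpha>\<close> close to \<open>1\<close>.
\<close>

lemma ex_extremal_center:
  assumes R: "0 < R" "R < 1" and gap: "bohr_gap k R < 0"
  obtains \<alpha> where "0 < \<alpha>" "\<alpha> < 1"
    "1 < (\<alpha> + R ^ k) / (1 + \<alpha> * R ^ k) + (1 - \<alpha>\<^sup>2) * R / (1 - \<alpha> * R)"
proof -
  define x where "x = R ^ k"
  have x: "0 \<le> x" "x \<le> 1" using R by (auto simp: x_def power_le_one)
  have "((\<lambda>\<alpha>. (1 + \<alpha>) * R / (1 - \<alpha> * R) - (1 - x) / (1 + \<alpha> * x)) \<longlongrightarrow>
      (1 + 1) * R / (1 - 1 * R) - (1 - x) / (1 + 1 * x)) (at_left 1)"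
    using R x by (intro tendsto_intros) auto
  moreover have "0 < (1 + 1) * R / (1 - 1 * R) - (1 - x) / (1 + 1 * x)"
    using gap by (simp add: bohr_gap_def x_def)
  ultimately have "\<forall>\<^sub>F \<alpha> in at_left 1. 0 < (1 + \<alpha>) * R / (1 - \<alpha> * R) - (1 - x) / (1 + \<alpha> * x)"
    by (rule order_tendstoD)
  moreover have "\<forall>\<^sub>F \<alpha> in at_left (1::real). \<alpha> \<in> {0<..<1}"
    by (rule eventually_at_left_real) simp
  ultimately have "\<forall>\<^sub>F \<alpha> in at_left (1::real). 0 < \<alpha> \<and> \<alpha> < 1 \<and>
      0 < (1 + \<alpha>) * R / (1 - \<alpha> * R) - (1 - x) / (1 + \<alpha> * x)"
    by eventually_elim simp
  from eventually_happens'[OF trivial_limit_at_left_real this] obtain \<alpha>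
    where \<alpha>: "0 < \<alpha>" "\<alpha> < 1"
      and less: "0 < (1 + \<alpha>) * R / (1 - \<alpha> * R) - (1 - x) / (1 + \<alpha> * x)" by blast
  have "0 < (1 - \<alpha>) * ((1 + \<alpha>) * R / (1 - \<alpha> * R) - (1 - x) / (1 + \<alpha> * x))"
    using \<alpha> less by (intro mult_pos_pos) auto
  also have "\<dots> = (1 - \<alpha>\<^sup>2) * R / (1 - \<alpha> * R) - (1 - (\<alpha> + x) / (1 + \<alpha> * x))"
    using one_minus_moebius[of \<alpha> x] \<alpha> x by (simp add: power2_eq_square algebra_simps)
  finally show ?thesis using that[OF \<alpha>] by (simp add: x_def)
qed

lemma bohr_radius_sharp:
  assumes X: "\<exists>x::'a::complex_banach. x \<noteq> 0" and k: "k \<ge> 1" and R: "bohr_radius k < R" "R < 1"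
  obtains a :: "complex ^ 'm" and F :: "'a::complex_banach \<Rightarrow> complex ^ 'm" and \<nu> z
  where "polydisc_map a F" "schwarz_map \<nu>" "vanishes_to_order k \<nu>" "norm z = R" "1 < bohr_lhs a F \<nu> z"
proof -
  obtain x0 :: 'a where x0: "x0 \<noteq> 0" using X by blast
  obtain \<phi> where \<phi>: "functional \<phi>" "\<phi> x0 = complex_of_real (norm x0)"
    using ex_norming_functional by blast
  have R0: "0 < R" using bohr_radius_pos[OF k] R by simp
  obtain \<alpha> where \<alpha>: "0 < \<alpha>" "\<alpha> < 1"
    and gt: "1 < (\<alpha> + R ^ k) / (1 + \<alpha> * R ^ k) + (1 - \<alpha>\<^sup>2) * R / (1 - \<alpha> * R)"
    using ex_extremal_center[OF R0 R(2) bohr_gap_neg[OF k R]] by blast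
  define one where "one = (\<chi> i. 1 :: complex ^ 'm)"
  define a where "a = of_real \<alpha> *\<^sub>C one"
  define F where "F z = blaschke \<alpha> (\<phi> z) *\<^sub>C one" for z
  define \<nu> where "\<nu> = (\<lambda>z. (- (\<phi> z ^ (k - 1))) *\<^sub>C z)"
  \<comment> \<open>The multiple of \<open>x0\<close> at which \<open>\<phi>\<close> takes the value \<open>R\<close>.\<close>
  define z where "z = complex_of_real (R / norm x0) *\<^sub>C x0"
  have nz: "norm z = R" unfolding z_def norm_scaleC norm_of_real using x0 R0 by simp
  have \<phi>z: "\<phi> z = of_real R" using x0 by (simp add: z_def functional_scaleC[OF \<phi>(1)] \<phi>(2))
  have F: "polydisc_map a F"
    unfolding a_def F_def one_def by (rule blaschke_polydisc_map[OF \<phi>(1)]) (use \<alpha> in auto)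
  have z1: "norm z < 1" using nz R by simp
  \<comment> \<open>The sign in \<open>\<nu>\<close> moves \<open>\<phi> (\<nu> z)\<close> to the negative axis, where the modulus of the Blaschke factor is largest.\<close>
  have "\<phi> (\<nu> z) = - of_real (R ^ k)"
    using k by (cases k) (simp_all add: \<nu>_def functional_scaleC[OF \<phi>(1)] \<phi>z mult.commute)
  then have "blaschke \<alpha> (\<phi> (\<nu> z)) = of_real ((\<alpha> + R ^ k) / (1 + \<alpha> * R ^ k))"
    by (simp add: blaschke_def)
  then have "maxnorm (F (\<nu> z)) = \<bar>(\<alpha> + R ^ k) / (1 + \<alpha> * R ^ k)\<bar>"
    unfolding F_def one_def maxnorm_scaleC_ones by (simp only: norm_of_real)
  then have growth: "(\<alpha> + R ^ k) / (1 + \<alpha> * R ^ k) \<le> maxnorm (F (\<nu> z))" by (simp only: abs_ge_self)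
  have aR: "1 - \<alpha> * R \<noteq> 0" using \<alpha> R R0 mult_strict_mono[of \<alpha> 1 R 1] by simp
  have "F z - a = (blaschke \<alpha> (of_real R) - of_real \<alpha>) *\<^sub>C one"
    by (simp add: F_def a_def \<phi>z one_def scaleC_vec_def scaleC_complex_def vec_eq_iff)
  also have "blaschke \<alpha> (of_real R) - of_real \<alpha> = of_real (- ((1 - \<alpha>\<^sup>2) * R / (1 - \<alpha> * R)))"
  proof -
    have "blaschke \<alpha> (of_real R) - of_real \<alpha> = of_real ((\<alpha> - R) / (1 - \<alpha> * R) - \<alpha>)"
      by (simp add: blaschke_def)
    also have "(\<alpha> - R) / (1 - \<alpha> * R) - \<alpha> = - ((1 - \<alpha>\<^sup>2) * R / (1 - \<alpha> * R))"
      using aR by (simp add: field_simps power2_eq_square)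
    finally show ?thesis .
  qed
  finally have "maxnorm (F z - a) = \<bar>- ((1 - \<alpha>\<^sup>2) * R / (1 - \<alpha> * R))\<bar>"
    unfolding one_def by (simp only: maxnorm_scaleC_ones norm_of_real)
  then have tail: "(1 - \<alpha>\<^sup>2) * R / (1 - \<alpha> * R) \<le> (\<Sum>n. maxnorm (taylor_term F (Suc n) z))"
    using maxnorm_le_suminf_taylor[OF F z1] abs_ge_minus_self[of "- ((1 - \<alpha>\<^sup>2) * R / (1 - \<alpha> * R))"]
    by linarith
  \<comment> \<open>The first two terms already exceed \<open>1\<close>, so a lower bound \<open>0\<close> for the quadratic term suffices.\<close>
  have "0 \<le> (1 / (1 + maxnorm a) + norm z / (1 - norm z)) * (\<Sum>n. (maxnorm (taylor_term F (Suc n) z))\<^sup>2)"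
    using suminf_nonneg[OF summable_taylor_square[OF F z1]] z1 maxnorm_nonneg[of a]
    by (intro mult_nonneg_nonneg add_nonneg_nonneg) auto
  then have "1 < bohr_lhs a F \<nu> z" using growth tail gt unfolding bohr_lhs_def by linarith
  moreover have "schwarz_map \<nu>" "vanishes_to_order k \<nu>"
    unfolding \<nu>_def using power_schwarz_map[OF \<phi>(1) k] by simp_all
  ultimately show ?thesis using that F nz by blast
qed

theorem theorem3p3:
  fixes k :: nat
  assumes "\<exists>x::'a::complex_banach. x \<noteq> 0"
    and "k \<ge> 1"
  shows "(\<exists>!r. is_bohr_root k r) \<and>
    (\<forall>(a :: complex ^ 'm) (F :: 'a \<Rightarrow> complex ^ 'm) z. polydisc_map a F \<longrightarrow> norm z < 1 \<longrightarrow>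
       summable (\<lambda>n. maxnorm (taylor_term F (Suc n) z)) \<and>
       summable (\<lambda>n. (maxnorm (taylor_term F (Suc n) z))\<^sup>2)) \<and>
    (\<forall>(a :: complex ^ 'm) (F :: 'a \<Rightarrow> complex ^ 'm) \<nu> z.
       polydisc_map a F \<longrightarrow> schwarz_map \<nu> \<longrightarrow> vanishes_to_order k \<nu> \<longrightarrow>
       norm z \<le> bohr_radius k \<longrightarrow> bohr_lhs a F \<nu> z \<le> 1) \<and>
    (\<forall>R. bohr_radius k < R \<longrightarrow> R < 1 \<longrightarrow>
       \<not> (\<forall>(a :: complex ^ 'm) (F :: 'a \<Rightarrow> complex ^ 'm) \<nu> z.
            polydisc_map a F \<longrightarrow> schwarz_map \<nu> \<longrightarrow> vanishes_to_order k \<nu> \<longrightarrow>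
            norm z \<le> R \<longrightarrow> bohr_lhs a F \<nu> z \<le> 1))"
proof (intro conjI allI impI notI)
  show "\<exists>!r. is_bohr_root k r" by (rule ex1_bohr_root[OF assms(2)])
next
  fix a :: "complex ^ 'm" and F :: "'a \<Rightarrow> complex ^ 'm" and z :: 'a
  assume "polydisc_map a F" "norm z < 1"
  then show "summable (\<lambda>n. maxnorm (taylor_term F (Suc n) z))"
    "summable (\<lambda>n. (maxnorm (taylor_term F (Suc n) z))\<^sup>2)"
    by (rule summable_taylor, rule summable_taylor_square)
next
  fix a :: "complex ^ 'm" and F :: "'a \<Rightarrow> complex ^ 'm" and \<nu> :: "'a \<Rightarrow> 'a" and z :: 'a
  assume "polydisc_map a F" "schwarz_map \<nu>" "vanishes_to_order k \<nu>" "norm z \<le> bohr_radius k"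
  moreover from this have "norm z < 1" using bohr_radius_le[OF assms(2)] by simp
  ultimately show "bohr_lhs a F \<nu> z \<le> 1" using bohr_lhs_le assms(2) by blast
next
  fix R
  assume R: "bohr_radius k < R" "R < 1"
    and le: "\<forall>(a :: complex ^ 'm) (F :: 'a \<Rightarrow> complex ^ 'm) \<nu> z.
            polydisc_map a F \<longrightarrow> schwarz_map \<nu> \<longrightarrow> vanishes_to_order k \<nu> \<longrightarrow>
            norm z \<le> R \<longrightarrow> bohr_lhs a F \<nu> z \<le> 1"
  obtain a :: "complex ^ 'm" and F :: "'a \<Rightarrow> complex ^ 'm" and \<nu> z
    where "polydisc_map a F" "schwarz_map \<nu>" "vanishes_to_order k \<nu>" "norm z = R" "1 < bohr_lhs a F \<nu> z"
    by (rule bohr_radius_sharp[OF assms R])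
  then show False using le by (metis linorder_not_less order_refl)
qed

end
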